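(* Let $\alpha\in(0,1)$, $\beta\in(0,1-\alpha)$, $t\ge2$. For the testing problem $H_0:\pi\in S$ versus $H_1:W_1(\pi,S)\ge\epsilon$, given two independent samples $X_1,\dots,X_n$ and $Y_1,\dots,Y_n$ i.i.d. from $P_\pi$, the debiased Cochran's $\chi^2$ test $$\psi_R=I\Big(R(X,Y)>\sup_{\pi\in S}q_\alpha(P_\pi,R)\Big),\qquad R(X,Y)=\frac{\hat V(X)}{\max(\hat\mu(Y),\gamma)},$$ with truncation parameter $\gamma\gtrsim n^{-1}$ (i.e. $\gamma\ge c/n$ for a constant $c>0$) is optimal up to constants: it controls the type I error by $\alpha$ uniformly over $\pi\in S$, and there is a constant $C$ depending only on $\alpha,\beta,c$ such that, for all $n$ large enough, its type II error is at most $\beta$ for every $\pi\in D$ with $W_1(\pi,S)\ge\epsilon$, whenever $\epsilon\ge C\epsilon_*(n,t)$.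
   Context: $n\ge2$. $D$ is the set of all probability distributions on $[0,1]$; $S=\{\delta_p:p\in[0,1]\}$; $W_1$ is the 1-Wasserstein distance and $W_1(\pi,S)=\inf_{s\in S}W_1(\pi,s)$. For $\pi\in D$, $P_\pi$ is the binomial mixture on $\{0,\dots,t\}$ with $P_\pi(\{j\})=E_{p\sim\pi}\big[\binom tj p^j(1-p)^{t-j}\big]$; $P_\pi^n$ its $n$-fold product. $q_\alpha(P_\pi,R)=\inf\{u:P(R(X,Y)>u)\le\alpha\}$ when all $X_i,Y_i$ are i.i.d. from $P_\pi$. The statistics are $$\hat V(X)=\binom n2^{-1}\sum_{i<j}\frac{h(X_i,X_j)}2,\quad h(x,y)=\frac{\binom x2}{\binom t2}+\frac{\binom y2}{\binom t2}-2\frac xt\frac yt,$$ $$\hat\mu(Y)=\binom n2^{-1}\sum_{i<j}\frac{\tilde h(Y_i,Y_j)}2,\quad \tilde h(x,y)=\frac xt+\frac yt-2\frac{xy}{t^2}.$$ Critical separation (for $n$ observations): with $\Psi(S)=\{\psi:\{0,\dots,t\}^n\to\{0,1\}\ :\ \sup_{\pi_0\in S}P_{\pi_0}^n(\psi(X)=1)\le\alpha\}$ and $R_*(\epsilon,S)=\inf_{\psi\in\Psi(S)}\sup_{\pi\in D:\,W_1(\pi,S)\ge\epsilon}P_\pi^n(\psi(X)=0)$ (supremum over the empty set is $0$), $\epsilon_*(n,t)=\inf\{\epsilon:R_*(\epsilon,S)\le\beta\}$. *)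

theory Defs
  imports "HOL-Probability.Probability"
begin

text \<open>A distribution on [0,1] is represented as a Borel probability measure on the real line
  that gives full mass to [0,1].\<close>

definition mixing_dists :: "real measure set" where
  "mixing_dists = {\<pi>. prob_space \<pi> \<and> sets \<pi> = sets borel \<and> measure \<pi> {0..1} = 1}"

definition point_masses :: "real measure set" where
  "point_masses = return borel ` {0..1}"

definition couplings :: "real measure \<Rightarrow> real measure \<Rightarrow> (real \<times> real) measure set" where
  "couplings \<pi> \<rho> = {\<Gamma>. prob_space \<Gamma> \<and> sets \<Gamma> = sets (borel \<Otimes>\<^sub>M borel) \<and>
     distr \<Gamma> borel fst = \<pi> \<and> distr \<Gamma> borel snd = \<rho>}"

text \<open>The infimum is over a nonempty set of nonnegative reals for all arguments in
  \<^const>\<open>mixing_dists\<close> (the product measure is a coupling, and the cost is bounded by 1 almost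
  everywhere).\<close>

definition W1 :: "real measure \<Rightarrow> real measure \<Rightarrow> real" where
  "W1 \<pi> \<rho> = (INF \<Gamma>\<in>couplings \<pi> \<rho>. LINT z|\<Gamma>. \<bar>fst z - snd z\<bar>)"

definition W1_set :: "real measure \<Rightarrow> real measure set \<Rightarrow> real" where
  "W1_set \<pi> A = (INF \<rho>\<in>A. W1 \<pi> \<rho>)"

definition binomial_mixture :: "nat \<Rightarrow> real measure \<Rightarrow> nat measure" where
  "binomial_mixture t \<pi> = point_measure {..t}
     (\<lambda>j. ennreal (LINT p|\<pi>. real (t choose j) * p ^ j * (1 - p) ^ (t - j)))"

text \<open>Samples of size n are indexed by 0, ..., n-1; the sample space is
  \<^term>\<open>{..<n} \<rightarrow>\<^sub>E {..t}\<close>, on which every subset is measurable.\<close>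

definition sample :: "nat \<Rightarrow> nat measure \<Rightarrow> (nat \<Rightarrow> nat) measure" where
  "sample n P = PiM {..<n} (\<lambda>_. P)"

definition two_samples :: "nat \<Rightarrow> nat measure \<Rightarrow> ((nat \<Rightarrow> nat) \<times> (nat \<Rightarrow> nat)) measure" where
  "two_samples n P = sample n P \<Otimes>\<^sub>M sample n P"

definition h_kernel :: "nat \<Rightarrow> nat \<Rightarrow> nat \<Rightarrow> real" where
  "h_kernel t x y = real (x choose 2) / real (t choose 2) + real (y choose 2) / real (t choose 2)
     - 2 * (real x / real t) * (real y / real t)"

definition V_hat :: "nat \<Rightarrow> nat \<Rightarrow> (nat \<Rightarrow> nat) \<Rightarrow> real" where
  "V_hat n t X = (\<Sum>j<n. \<Sum>i<j. h_kernel t (X i) (X j) / 2) / real (n choose 2)"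

definition h_tilde :: "nat \<Rightarrow> nat \<Rightarrow> nat \<Rightarrow> real" where
  "h_tilde t x y = real x / real t + real y / real t - 2 * (real x * real y / (real t)\<^sup>2)"

definition mu_hat :: "nat \<Rightarrow> nat \<Rightarrow> (nat \<Rightarrow> nat) \<Rightarrow> real" where
  "mu_hat n t Y = (\<Sum>j<n. \<Sum>i<j. h_tilde t (Y i) (Y j) / 2) / real (n choose 2)"

definition R_stat :: "nat \<Rightarrow> nat \<Rightarrow> real \<Rightarrow> (nat \<Rightarrow> nat) \<times> (nat \<Rightarrow> nat) \<Rightarrow> real" where
  "R_stat n t \<gamma> = (\<lambda>(X, Y). V_hat n t X / max (mu_hat n t Y) \<gamma>)"

definition upper_quantile ::
    "real \<Rightarrow> nat \<Rightarrow> nat measure \<Rightarrow> ((nat \<Rightarrow> nat) \<times> (nat \<Rightarrow> nat) \<Rightarrow> real) \<Rightarrow> real" where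
  "upper_quantile \<alpha> n P R =
     Inf {u. measure (two_samples n P) {z \<in> space (two_samples n P). R z > u} \<le> \<alpha>}"

definition cochran_test ::
    "real \<Rightarrow> nat \<Rightarrow> nat \<Rightarrow> real \<Rightarrow> (nat \<Rightarrow> nat) \<times> (nat \<Rightarrow> nat) \<Rightarrow> nat" where
  "cochran_test \<alpha> n t \<gamma> z =
     (if R_stat n t \<gamma> z >
         (SUP \<pi>\<in>point_masses. upper_quantile \<alpha> n (binomial_mixture t \<pi>) (R_stat n t \<gamma>))
      then 1 else 0)"

definition level_tests ::
    "real \<Rightarrow> nat \<Rightarrow> nat \<Rightarrow> real measure set \<Rightarrow> ((nat \<Rightarrow> nat) \<Rightarrow> nat) set" where
  "level_tests \<alpha> n t S = {\<psi> \<in> ({..<n} \<rightarrow>\<^sub>E {..t}) \<rightarrow> {0, 1}.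
     (SUP \<pi>\<in>S. measure (sample n (binomial_mixture t \<pi>))
        {X \<in> space (sample n (binomial_mixture t \<pi>)). \<psi> X = 1}) \<le> \<alpha>}"

text \<open>Inserting 0 makes the supremum over an empty set of alternatives equal to 0 and changes
  nothing otherwise, since probabilities are nonnegative.\<close>

definition worst_type_II ::
    "nat \<Rightarrow> nat \<Rightarrow> real \<Rightarrow> real measure set \<Rightarrow> ((nat \<Rightarrow> nat) \<Rightarrow> nat) \<Rightarrow> real" where
  "worst_type_II n t \<epsilon> S \<psi> = Sup (insert 0
     ((\<lambda>\<pi>. measure (sample n (binomial_mixture t \<pi>))
         {X \<in> space (sample n (binomial_mixture t \<pi>)). \<psi> X = 0})
      ` {\<pi> \<in> mixing_dists. W1_set \<pi> S \<ge> \<epsilon>}))"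

definition minimax_risk :: "real \<Rightarrow> nat \<Rightarrow> nat \<Rightarrow> real \<Rightarrow> real measure set \<Rightarrow> real" where
  "minimax_risk \<alpha> n t \<epsilon> S = (INF \<psi>\<in>level_tests \<alpha> n t S. worst_type_II n t \<epsilon> S \<psi>)"

text \<open>With S the set of point masses and \<beta> < 1 - \<alpha>, no nonpositive \<epsilon> belongs to the set below
  (point masses would be alternatives), and every \<epsilon> > 1 does; so the real infimum is proper.\<close>

definition critical_separation ::
    "real \<Rightarrow> real \<Rightarrow> nat \<Rightarrow> nat \<Rightarrow> real measure set \<Rightarrow> real" where
  "critical_separation \<alpha> \<beta> n t S = Inf {\<epsilon>. minimax_risk \<alpha> n t \<epsilon> S \<le> \<beta>}"

end

theory Submission
  imports Defs
begin

text \<open>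
  The level of the test is immediate: on a finite sample space the upper quantile is attained, and
  the threshold of the test dominates every null quantile.

  For the power, the critical separation is bounded below by constant multiples of
  \<open>1 / n\<close> and of \<open>1 / sqrt (t * sqrt n)\<close>. The first bound compares
  the point mass at 0 with a mixture of the point masses at 0 and 1
  (\<open>critical_separation_ge_inverse_n\<close>), the second is a chi-square bound for the
  two-point mixture at \<open>1 / 2 - s\<close> and \<open>1 / 2 + s\<close>
  (\<open>critical_separation_ge_local\<close>).

  Given success probabilities \<open>p i\<close>, the statistic \<open>V_hat\<close> has the sample
  variance of the \<open>p i\<close> as its mean, and its variance is explicitly controlled
  (\<open>V_hat_second_moment\<close>). Under the null, where all \<open>p i\<close> equal some
  \<open>p\<close>, let \<open>v = p * (1 - p)\<close>. With high probability
  \<open>V_hat = O(v / (t * sqrt n))\<close>, while \<open>max mu_hat \<gamma>\<close> is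
  at least of order \<open>max v \<gamma>\<close> if \<open>v\<close> is a large multiple of
  \<open>1 / n\<close> and at least \<open>\<gamma>\<close> in any case; hence the threshold of
  the test is at most a constant multiple of
  \<open>1 / (t * sqrt n * max 1 \<gamma>)\<close> (\<open>null_R_stat_tail\<close>). As
  the denominator of the statistic never exceeds \<open>max 1 \<gamma>\<close>, the test rejects
  as soon as \<open>V_hat\<close> exceeds \<open>K / (t * sqrt n)\<close> for a constant
  \<open>K\<close>, uniformly in \<open>\<gamma>\<close>.

  Under the alternative the variance of \<open>\<pi>\<close> may be dominated by rare large
  deviations, so Chebyshev's inequality does not apply to \<open>V_hat\<close> directly. Instead one
  conditions on the success probabilities. A distance \<open>\<epsilon>\<close> from all point
  masses means that the mean absolute deviation about every centre is at least
  \<open>\<epsilon>\<close>; as deviations are at most 1, an exponential moment bound shows that the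
  sample variance of the \<open>p i\<close> is at least \<open>\<epsilon>\<^sup>2 / 64\<close>
  except with probability \<open>exp (- (n div 2) * \<epsilon> / 4)\<close>, which is small
  when \<open>\<epsilon>\<close> is a large multiple of \<open>1 / n\<close>. Given such success
  probabilities, Chebyshev's inequality applies with \<open>\<epsilon>\<^sup>2\<close> a large
  multiple of \<open>1 / (t * sqrt n)\<close> (\<open>V_hat_lower_tail\<close>).
\<close>

section \<open>Expectations under finite product laws\<close>

text \<open>Expectation of \<open>f\<close> under the weights \<open>u\<close> on
  \<open>{0, \<dots>, t}\<close>, and expectation of a statistic under the product of
  \<open>n\<close> such laws, the i-th with weights \<open>w i\<close>. All sample spaces are
  finite, so both are finite sums and no integrability conditions occur. The factors are
  allowed to differ because the observations are also studied conditionally on their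
  individual success probabilities.\<close>

definition mexp :: "nat \<Rightarrow> (nat \<Rightarrow> real) \<Rightarrow> (nat \<Rightarrow> real) \<Rightarrow> real" where
  "mexp t u f = (\<Sum>j\<le>t. u j * f j)"

definition pexp :: "nat \<Rightarrow> nat \<Rightarrow> (nat \<Rightarrow> nat \<Rightarrow> real) \<Rightarrow> ((nat \<Rightarrow> nat) \<Rightarrow> real) \<Rightarrow> real" where
  "pexp n t w f = (\<Sum>X\<in>{..<n} \<rightarrow>\<^sub>E {..t}. (\<Prod>i<n. w i (X i)) * f X)"

lemma finite_sample_space [simp]: "finite ({..<n::nat} \<rightarrow>\<^sub>E {..t::nat})"
  by (intro finite_PiE) auto

lemma mexp_add: "mexp t u (\<lambda>j. f j + g j) = mexp t u f + mexp t u g"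
  by (simp add: mexp_def distrib_left sum.distrib)

lemma mexp_diff: "mexp t u (\<lambda>j. f j - g j) = mexp t u f - mexp t u g"
  by (simp add: mexp_def right_diff_distrib sum_subtractf)

lemma mexp_cmult: "mexp t u (\<lambda>j. a * f j) = a * mexp t u f"
  by (simp add: mexp_def sum_distrib_left mult_ac)

lemma pexp_add: "pexp n t w (\<lambda>X. f X + g X) = pexp n t w f + pexp n t w g"
  by (simp add: pexp_def distrib_left sum.distrib)

lemma pexp_cmult: "pexp n t w (\<lambda>X. a * f X) = a * pexp n t w f"
  by (simp add: pexp_def sum_distrib_left mult_ac)

lemma pexp_sum: "pexp n t w (\<lambda>X. \<Sum>k\<in>K. f k X) = (\<Sum>k\<in>K. pexp n t w (f k))"
  unfolding pexp_def by (simp add: sum_distrib_left sum.swap[of _ K])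

lemma pexp_cong:
  "(\<And>X. X \<in> {..<n} \<rightarrow>\<^sub>E {..t} \<Longrightarrow> f X = g X) \<Longrightarrow> pexp n t w f = pexp n t w g"
  by (simp add: pexp_def)

lemma pexp_prod:
  "pexp n t w (\<lambda>X. \<Prod>i<n. f i (X i)) = (\<Prod>i<n. mexp t (w i) (f i))"
  by (simp add: pexp_def mexp_def prod_sum_PiE prod.distrib)

lemma prod_power_of_bool:
  fixes y :: "nat \<Rightarrow> real"
  assumes "i < n"
  shows "(\<Prod>m<n. y m ^ of_bool (m = i)) = y i"
proof -
  have "(\<Prod>m<n. y m ^ of_bool (m = i)) = (\<Prod>m<n. if m = i then y m else 1)"
    by (intro prod.cong) auto
  then show ?thesis using \<open>i < n\<close> by simp
qed

text \<open>The weights of each factor form a probability distribution.\<close>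

locale product_weights =
  fixes n t :: nat and w :: "nat \<Rightarrow> nat \<Rightarrow> real"
  assumes w_nonneg: "\<And>i j. i < n \<Longrightarrow> j \<le> t \<Longrightarrow> 0 \<le> w i j"
    and w_total: "\<And>i. i < n \<Longrightarrow> (\<Sum>j\<le>t. w i j) = 1"
begin

lemma mexp_const: "i < n \<Longrightarrow> mexp t (w i) (\<lambda>_. a) = a"
  by (simp add: mexp_def w_total flip: sum_distrib_right)

lemma pexp_const: "pexp n t w (\<lambda>_. a) = a"
proof -
  have "pexp n t w (\<lambda>X. \<Prod>i<n. 1) = (\<Prod>i<n. mexp t (w i) (\<lambda>_. 1))"
    by (rule pexp_prod)
  also have "\<dots> = 1"
    by (intro prod.neutral) (auto simp: mexp_const)
  finally have "pexp n t w (\<lambda>_. 1) = 1" by simp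
  then show ?thesis using pexp_cmult[of n t w a "\<lambda>_. 1"] by simp
qed

lemma weight_nonneg: "X \<in> {..<n} \<rightarrow>\<^sub>E {..t} \<Longrightarrow> 0 \<le> (\<Prod>i<n. w i (X i))"
  by (intro prod_nonneg) (auto intro!: w_nonneg simp: PiE_iff)

lemma pexp_mono:
  assumes "\<And>X. X \<in> {..<n} \<rightarrow>\<^sub>E {..t} \<Longrightarrow> f X \<le> g X"
  shows "pexp n t w f \<le> pexp n t w g"
  unfolding pexp_def by (intro sum_mono mult_left_mono assms weight_nonneg)

lemma chebyshev:
  assumes "0 < s" and "\<And>X. X \<in> {..<n} \<rightarrow>\<^sub>E {..t} \<Longrightarrow> P X \<Longrightarrow> s \<le> \<bar>f X\<bar>"
  shows "pexp n t w (\<lambda>X. of_bool (P X)) \<le> pexp n t w (\<lambda>X. (f X)\<^sup>2) / s\<^sup>2"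
proof -
  have "pexp n t w (\<lambda>X. of_bool (P X)) \<le> pexp n t w (\<lambda>X. (1 / s\<^sup>2) * (f X)\<^sup>2)"
  proof (rule pexp_mono)
    fix X assume X: "X \<in> {..<n} \<rightarrow>\<^sub>E {..t}"
    show "of_bool (P X) \<le> (1 / s\<^sup>2) * (f X)\<^sup>2"
    proof (cases "P X")
      case True
      then have "s\<^sup>2 \<le> \<bar>f X\<bar>\<^sup>2"
        using assms X by (intro power_mono) auto
      then show ?thesis using \<open>0 < s\<close> by (simp add: field_simps)
    qed auto
  qed
  also have "\<dots> = pexp n t w (\<lambda>X. (f X)\<^sup>2) / s\<^sup>2"
    by (subst pexp_cmult) simp
  finally show ?thesis .
qed

text \<open>Centred functions of different coordinates are orthogonal.\<close>

lemma pexp_linear_square: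
  assumes zero: "\<And>i. i < n \<Longrightarrow> mexp t (w i) (g i) = 0"
  shows "pexp n t w (\<lambda>X. (\<Sum>i<n. g i (X i))\<^sup>2) = (\<Sum>i<n. mexp t (w i) (\<lambda>x. (g i x)\<^sup>2))"
proof -
  have cross: "pexp n t w (\<lambda>X. g i (X i) * g k (X k)) =
      (if k = i then mexp t (w i) (\<lambda>x. (g i x)\<^sup>2) else 0)" if "i < n" "k < n" for i k
  proof -
    define c :: "nat \<Rightarrow> nat" where "c m = of_bool (m = i) + of_bool (m = k)" for m
    have "pexp n t w (\<lambda>X. g i (X i) * g k (X k)) = pexp n t w (\<lambda>X. \<Prod>m<n. g m (X m) ^ c m)"
      using that by (simp add: c_def power_add prod.distrib prod_power_of_bool)
    also have "\<dots> = (\<Prod>m<n. mexp t (w m) (\<lambda>x. g m x ^ c m))"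
      by (rule pexp_prod)
    also have "\<dots> = (if k = i then mexp t (w i) (\<lambda>x. (g i x)\<^sup>2) else 0)"
    proof (cases "k = i")
      case True
      have "(\<Prod>m<n. mexp t (w m) (\<lambda>x. g m x ^ c m)) =
          (\<Prod>m<n. if m = i then mexp t (w m) (\<lambda>x. (g m x)\<^sup>2) else 1)"
        using True by (intro prod.cong refl) (auto simp: c_def mexp_const power2_eq_square)
      with True that show ?thesis by simp
    next
      case False
      then have "mexp t (w i) (\<lambda>x. g i x ^ c i) = 0"
        using that by (simp add: c_def zero)
      with False that show ?thesis by (auto intro: prod_zero)
    qed
    finally show ?thesis .
  qed
  have "pexp n t w (\<lambda>X. (\<Sum>i<n. g i (X i))\<^sup>2) =
      (\<Sum>i<n. \<Sum>k<n. pexp n t w (\<lambda>X. g i (X i) * g k (X k)))"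
    by (simp add: power2_eq_square sum_product pexp_sum)
  also have "\<dots> = (\<Sum>i<n. \<Sum>k<n. if k = i then mexp t (w i) (\<lambda>x. (g i x)\<^sup>2) else 0)"
    by (intro sum.cong refl cross) auto
  finally show ?thesis by simp
qed

text \<open>The products \<open>e i * e j\<close> over different pairs \<open>i < j\<close> are
  orthogonal as well, so the degenerate quadratic form has an explicit second moment.\<close>

lemma pexp_quadratic_square:
  assumes zero: "\<And>i. i < n \<Longrightarrow> mexp t (w i) (e i) = 0"
  shows "pexp n t w (\<lambda>X. (\<Sum>j<n. \<Sum>i<j. e i (X i) * e j (X j))\<^sup>2) =
    (\<Sum>j<n. \<Sum>i<j. mexp t (w i) (\<lambda>x. (e i x)\<^sup>2) * mexp t (w j) (\<lambda>x. (e j x)\<^sup>2))"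
proof -
  define s where "s i = mexp t (w i) (\<lambda>x. (e i x)\<^sup>2)" for i
  define Q where "Q = (SIGMA j:{..<n}. {..<j})"
  define F where "F q X = e (snd q) (X (snd q)) * e (fst q) (X (fst q))" for q X
  have finQ: "finite Q" by (auto simp: Q_def)
  have cross: "pexp n t w (\<lambda>X. F q X * F r X) = (if r = q then s (fst q) * s (snd q) else 0)"
    if qr: "q \<in> Q" "r \<in> Q" for q r
  proof -
    obtain j i where q: "q = (j, i)" "i < j" "j < n" using qr by (auto simp: Q_def)
    obtain l k where r: "r = (l, k)" "k < l" "l < n" using qr by (auto simp: Q_def)
    define c :: "nat \<Rightarrow> nat" where
      "c m = of_bool (m = i) + of_bool (m = j) + of_bool (m = k) + of_bool (m = l)" for m
    have "pexp n t w (\<lambda>X. F q X * F r X) = pexp n t w (\<lambda>X. \<Prod>m<n. e m (X m) ^ c m)"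
      using q r by (simp add: c_def F_def power_add prod.distrib prod_power_of_bool mult_ac)
    also have "\<dots> = (\<Prod>m<n. mexp t (w m) (\<lambda>x. e m x ^ c m))"
      by (rule pexp_prod)
    also have "\<dots> = (if r = q then s (fst q) * s (snd q) else 0)"
    proof (cases "r = q")
      case True
      have "(\<Prod>m<n. mexp t (w m) (\<lambda>x. e m x ^ c m)) =
          (\<Prod>m<n. (if m = i then s m else 1) * (if m = j then s m else 1))"
        using True q r by (intro prod.cong refl) (auto simp: c_def mexp_const power2_eq_square s_def)
      with True q r show ?thesis by (simp add: prod.distrib)
    next
      case False
      \<comment> \<open>two different pairs leave some index that occurs exactly once\<close>
      have "\<exists>m<n. c m = 1"
      proof (cases "i = k")
        case True
        with False q r have "c j = 1" by (auto simp: c_def)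
        with q show ?thesis by auto
      next
        case ik: False
        show ?thesis
        proof (cases "i = l")
          case True
          with ik q r have "c k = 1" by (auto simp: c_def)
          with r show ?thesis by (intro exI[of _ k]) auto
        next
          case False
          with ik q have "c i = 1" by (auto simp: c_def)
          with q show ?thesis by (intro exI[of _ i]) auto
        qed
      qed
      then obtain m where "m < n" "c m = 1" by auto
      then have "mexp t (w m) (\<lambda>x. e m x ^ c m) = 0" by (simp add: zero)
      with False \<open>m < n\<close> show ?thesis by (auto intro: prod_zero)
    qed
    finally show ?thesis .
  qed
  have "(\<Sum>j<n. \<Sum>i<j. e i (X i) * e j (X j)) = (\<Sum>q\<in>Q. F q X)" for X
    unfolding Q_def F_def by (subst sum.Sigma) (auto simp: case_prod_beta)
  then have "pexp n t w (\<lambda>X. (\<Sum>j<n. \<Sum>i<j. e i (X i) * e j (X j))\<^sup>2) =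
      (\<Sum>q\<in>Q. \<Sum>r\<in>Q. pexp n t w (\<lambda>X. F q X * F r X))"
    by (simp add: power2_eq_square sum_product pexp_sum)
  also have "\<dots> = (\<Sum>q\<in>Q. \<Sum>r\<in>Q. if r = q then s (fst q) * s (snd q) else 0)"
    by (intro sum.cong refl cross)
  also have "\<dots> = (\<Sum>(j, i)\<in>Q. s i * s j)"
    using finQ by (simp add: case_prod_beta mult.commute)
  also have "\<dots> = (\<Sum>j<n. \<Sum>i<j. s i * s j)"
    unfolding Q_def by (subst sum.Sigma) auto
  finally show ?thesis by (simp add: s_def)
qed

end

section \<open>Binomial weights and their moments\<close>

text \<open>The weight of \<open>j\<close> under the binomial distribution with \<open>t\<close> trials.\<close>

definition bin_weight :: "nat \<Rightarrow> real \<Rightarrow> nat \<Rightarrow> real" where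
  "bin_weight t p j = real (t choose j) * p ^ j * (1 - p) ^ (t - j)"

lemma bin_weight_nonneg: "0 \<le> p \<Longrightarrow> p \<le> 1 \<Longrightarrow> 0 \<le> bin_weight t p j"
  by (simp add: bin_weight_def)

lemma sum_bin_weight: "(\<Sum>j\<le>t. bin_weight t p j) = 1"
  using binomial_ring[of p "1 - p" t] by (simp add: bin_weight_def)

text \<open>Factorial moments: one factor \<open>j\<close> is traded for \<open>t * p\<close> and one
  trial less.\<close>

lemma bin_weight_step:
  "mexp t (bin_weight t p) (\<lambda>j. real j * f (real j - 1)) =
     real t * p * mexp (t - 1) (bin_weight (t - 1) p) (\<lambda>j. f (real j))"
proof (cases t)
  case (Suc s)
  have "mexp t (bin_weight t p) (\<lambda>j. real j * f (real j - 1)) =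
      (\<Sum>j\<le>s. real (Suc j * (Suc s choose Suc j)) * p ^ Suc j * (1 - p) ^ (s - j) * f (real j))"
    unfolding mexp_def Suc sum.atMost_Suc_shift bin_weight_def
    by (simp add: algebra_simps del: binomial_Suc_Suc)
  also have "\<dots> = (\<Sum>j\<le>s. real (Suc s * (s choose j)) * p ^ Suc j * (1 - p) ^ (s - j) * f (real j))"
    by (simp only: Suc_times_binomial_eq mult.commute[of "Suc _ choose _"])
  also have "\<dots> = real t * p * mexp (t - 1) (bin_weight (t - 1) p) (\<lambda>j. f (real j))"
    unfolding mexp_def Suc bin_weight_def by (simp add: sum_distrib_left algebra_simps)
  finally show ?thesis .
qed (simp add: mexp_def)

lemma mexp_bin_const: "mexp t (bin_weight t p) (\<lambda>_. a) = a"
  by (simp add: mexp_def sum_bin_weight flip: sum_distrib_right)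

lemma bin_moment1: "mexp t (bin_weight t p) (\<lambda>j. real j) = real t * p"
  using bin_weight_step[of t p "\<lambda>_. 1"] by (simp add: mexp_bin_const)

lemma bin_moment2: "mexp t (bin_weight t p) (\<lambda>j. real j * (real j - 1)) = real t * (real t - 1) * p\<^sup>2"
  using bin_weight_step[of t p "\<lambda>x. x"] bin_moment1[of "t - 1" p]
  by (cases t) (simp_all add: power2_eq_square)

lemma bin_moment3:
  "mexp t (bin_weight t p) (\<lambda>j. real j * ((real j - 1) * (real j - 2))) =
     real t * (real t - 1) * (real t - 2) * p ^ 3"
  using bin_weight_step[of t p "\<lambda>x. x * (x - 1)"] bin_moment2[of "t - 1" p]
  by (cases t) (simp_all add: power2_eq_square power3_eq_cube)

lemma bin_moment4:
  "mexp t (bin_weight t p) (\<lambda>j. real j * ((real j - 1) * ((real j - 2) * (real j - 3)))) =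
     real t * (real t - 1) * (real t - 2) * (real t - 3) * p ^ 4"
  using bin_weight_step[of t p "\<lambda>x. x * ((x - 1) * (x - 2))"] bin_moment3[of "t - 1" p]
  by (cases t) (simp_all add: power2_eq_square power3_eq_cube power4_eq_xxxx)

section \<open>Algebra and moments of the sampling noise\<close>

lemma real_choose_two: "real (n choose 2) = real n * (real n - 1) / 2"
  by (induction n) (simp_all add: numeral_2_eq_2 field_simps)

text \<open>Centred versions of \<open>x / t\<close> and, after removing its linear part, of the
  unbiased estimator \<open>(x choose 2) / (t choose 2)\<close> of
  \<open>p\<^sup>2\<close>: the two orthogonal components of the sampling noise of one
  binomial observation.\<close>

definition noise :: "nat \<Rightarrow> real \<Rightarrow> nat \<Rightarrow> real" where
  "noise t p j = real j / real t - p"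

definition noise2 :: "nat \<Rightarrow> real \<Rightarrow> nat \<Rightarrow> real" where
  "noise2 t p j = real (j choose 2) / real (t choose 2) - 2 * p * (real j / real t) + p\<^sup>2"

lemma noise_mean: "1 \<le> t \<Longrightarrow> mexp t (bin_weight t p) (noise t p) = 0"
proof -
  assume t: "1 \<le> t"
  have "noise t p = (\<lambda>j. (1 / real t) * real j - p)" by (auto simp: noise_def)
  then show ?thesis using t by (simp only: mexp_diff mexp_cmult bin_moment1 mexp_bin_const) simp
qed

lemma noise_square: "1 \<le> t \<Longrightarrow> mexp t (bin_weight t p) (\<lambda>x. (noise t p x)\<^sup>2) = p * (1 - p) / real t"
proof -
  assume t: "1 \<le> t"
  have "(\<lambda>x. (noise t p x)\<^sup>2) = (\<lambda>j. (1 / (real t)\<^sup>2) * (real j * (real j - 1)) +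
      (1 / (real t)\<^sup>2 - 2 * p / real t) * real j + p\<^sup>2)"
    using t by (intro ext) (simp add: noise_def field_simps power2_eq_square)
  then show ?thesis using t
    by (simp only: mexp_add mexp_diff mexp_cmult bin_moment1 bin_moment2 mexp_bin_const)
       (simp add: field_simps power2_eq_square)
qed

lemma noise2_mean: "2 \<le> t \<Longrightarrow> mexp t (bin_weight t p) (noise2 t p) = 0"
proof -
  assume t: "2 \<le> t"
  then have t': "real t - 1 \<noteq> 0" "real t \<noteq> 0" by auto
  have "noise2 t p = (\<lambda>j. (1 / (real t * (real t - 1))) * (real j * (real j - 1)) -
      (2 * p / real t) * real j + p\<^sup>2)"
    using t' by (intro ext) (simp add: noise2_def real_choose_two field_simps)
  then show ?thesis using t'
    by (simp only: mexp_add mexp_diff mexp_cmult bin_moment1 bin_moment2 mexp_bin_const)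
       (simp add: power2_eq_square)
qed

lemma noise2_square:
  assumes "2 \<le> t"
  shows "mexp t (bin_weight t p) (\<lambda>x. (noise2 t p x)\<^sup>2) =
    2 * (p * (1 - p))\<^sup>2 / (real t * (real t - 1))"
proof -
  define T where "T = real t"
  have T: "T - 1 \<noteq> 0" "T \<noteq> 0" using assms by (auto simp: T_def)
  define a where "a = 1 / (T * (T - 1))"
  define b where "b = 2 * p / T"
  have n2: "noise2 t p j = a * (real j * (real j - 1)) - b * real j + p\<^sup>2" for j
    using T by (simp add: noise2_def real_choose_two a_def b_def T_def field_simps)
  have "(\<lambda>x. (noise2 t p x)\<^sup>2) = (\<lambda>j.
      a\<^sup>2 * (real j * ((real j - 1) * ((real j - 2) * (real j - 3)))) +
      (4 * a\<^sup>2 - 2 * a * b) * (real j * ((real j - 1) * (real j - 2))) +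
      (2 * a\<^sup>2 - 4 * a * b + b\<^sup>2 + 2 * p\<^sup>2 * a) * (real j * (real j - 1)) +
      (b\<^sup>2 - 2 * p\<^sup>2 * b) * real j + p ^ 4)"
    unfolding n2 by (intro ext) algebra
  then have "mexp t (bin_weight t p) (\<lambda>x. (noise2 t p x)\<^sup>2) =
      a\<^sup>2 * (T * (T - 1) * (T - 2) * (T - 3) * p ^ 4) +
      (4 * a\<^sup>2 - 2 * a * b) * (T * (T - 1) * (T - 2) * p ^ 3) +
      (2 * a\<^sup>2 - 4 * a * b + b\<^sup>2 + 2 * p\<^sup>2 * a) * (T * (T - 1) * p\<^sup>2) +
      (b\<^sup>2 - 2 * p\<^sup>2 * b) * (T * p) + p ^ 4"
    by (simp only: mexp_add mexp_cmult bin_moment1 bin_moment2 bin_moment3 bin_moment4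
        mexp_bin_const T_def)
  also have "\<dots> = 2 * (p * (1 - p))\<^sup>2 / (T * (T - 1))"
  proof -
    have aT: "a * (T * (T - 1)) = 1" "b * T = 2 * p" using T by (auto simp: a_def b_def)
    have "2 * (p * (1 - p))\<^sup>2 / (T * (T - 1)) = 2 * (p * (1 - p))\<^sup>2 * a" by (simp add: a_def)
    then show ?thesis using aT by algebra
  qed
  finally show ?thesis by (simp add: T_def)
qed

lemma sum_pairs_symmetric:
  fixes f g :: "nat \<Rightarrow> real"
  shows "(\<Sum>j<n. \<Sum>i<j. f i * g j + g i * f j) = (\<Sum>i<n. f i) * (\<Sum>i<n. g i) - (\<Sum>i<n. f i * g i)"
  by (induction n)
     (simp_all add: sum.distrib algebra_simps flip: sum_distrib_left sum_distrib_right)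

lemma sum_pairs_add:
  fixes f :: "nat \<Rightarrow> real"
  shows "(\<Sum>j<n. \<Sum>i<j. f i + f j) = (real n - 1) * (\<Sum>i<n. f i)"
  using sum_pairs_symmetric[of f "\<lambda>_. 1" n] by (simp add: algebra_simps)

lemma sum_pairs_mult:
  fixes f :: "nat \<Rightarrow> real"
  shows "(\<Sum>j<n. \<Sum>i<j. f i * f j) = ((\<Sum>i<n. f i)\<^sup>2 - (\<Sum>i<n. (f i)\<^sup>2)) / 2"
  using sum_pairs_symmetric[of f f n]
  by (simp add: power2_eq_square sum.distrib mult.commute flip: sum_distrib_left)

lemma sum_pairs_const: "(\<Sum>j<n. \<Sum>i<j. a) = real n * (real n - 1) / 2 * (a::real)"
  using sum_pairs_add[of "\<lambda>_. a / 2" n] by simp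

section \<open>Second moments of the two statistics\<close>

text \<open>Sample mean and unbiased sample variance (denominator \<open>n - 1\<close>) of
  \<open>p 0, \<dots>, p (n - 1)\<close>.\<close>

definition sample_mean :: "nat \<Rightarrow> (nat \<Rightarrow> real) \<Rightarrow> real" where
  "sample_mean n p = (\<Sum>i<n. p i) / real n"

definition sample_var :: "nat \<Rightarrow> (nat \<Rightarrow> real) \<Rightarrow> real" where
  "sample_var n p = (\<Sum>i<n. (p i - sample_mean n p)\<^sup>2) / (real n - 1)"

lemma sum_sq_dev:
  assumes "1 \<le> n"
  shows "(\<Sum>i<n. (p i - sample_mean n p)\<^sup>2) = (\<Sum>i<n. (p i)\<^sup>2) - (\<Sum>i<n. p i)\<^sup>2 / real n"
proof -
  have "(\<Sum>i<n. (p i - sample_mean n p)\<^sup>2) =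
     (\<Sum>i<n. (p i)\<^sup>2) - 2 * sample_mean n p * (\<Sum>i<n. p i) + real n * (sample_mean n p)\<^sup>2"
    by (simp add: power2_diff sum.distrib sum_subtractf sum_distrib_left mult_ac)
  also have "\<dots> = (\<Sum>i<n. (p i)\<^sup>2) - (\<Sum>i<n. p i)\<^sup>2 / real n"
    using assms by (simp add: sample_mean_def field_simps power2_eq_square)
  finally show ?thesis .
qed

text \<open>For arbitrary numbers \<open>p i\<close> the statistic is the sample variance of the
  \<open>p i\<close> plus a linear term, a sum of quadratic noise terms and a degenerate
  quadratic form. When \<open>X i\<close> is binomial with success probability
  \<open>p i\<close>, the last three are centred.\<close>

lemma V_hat_decomposition:
  assumes "2 \<le> n" "2 \<le> t"
  shows "V_hat n t X = sample_var n p
    + (\<Sum>i<n. 2 * (p i - sample_mean n p) / (real n - 1) * noise t (p i) (X i))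
    + (\<Sum>i<n. 1 / real n * noise2 t (p i) (X i))
    - 2 / (real n * (real n - 1)) * (\<Sum>j<n. \<Sum>i<j. noise t (p i) (X i) * noise t (p j) (X j))"
proof -
  define N where "N = real n"
  have N: "N \<noteq> 0" "N - 1 \<noteq> 0" using assms by (auto simp: N_def)
  define e where "e i = noise t (p i) (X i)" for i
  define k where "k i = noise2 t (p i) (X i)" for i
  define a where "a i = real (X i) / real t" for i
  define A where "A i = real (X i choose 2) / real (t choose 2)" for i
  have a: "a i = p i + e i" for i by (simp add: a_def e_def noise_def)
  have A: "A i = k i + (p i)\<^sup>2 + 2 * (p i * e i)" for i
    by (simp add: A_def k_def e_def noise_def noise2_def power2_eq_square algebra_simps)
  define P where "P = (\<Sum>i<n. p i)"
  define P2 where "P2 = (\<Sum>i<n. (p i)\<^sup>2)"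
  define E where "E = (\<Sum>i<n. e i)"
  define E2 where "E2 = (\<Sum>i<n. (e i)\<^sup>2)"
  define PE where "PE = (\<Sum>i<n. p i * e i)"
  define K where "K = (\<Sum>i<n. k i)"
  have "(\<Sum>j<n. \<Sum>i<j. h_kernel t (X i) (X j) / 2) = (\<Sum>j<n. \<Sum>i<j. (A i / 2 + A j / 2) - a i * a j)"
    by (intro sum.cong refl) (simp add: h_kernel_def A_def a_def field_simps)
  also have "\<dots> = (N - 1) * (\<Sum>i<n. A i / 2) - ((\<Sum>i<n. a i)\<^sup>2 - (\<Sum>i<n. (a i)\<^sup>2)) / 2"
    by (simp only: sum_subtractf sum_pairs_mult sum_pairs_add N_def)
  also have "(\<Sum>i<n. A i / 2) = (K + P2 + 2 * PE) / 2"
    by (simp add: A K_def P2_def PE_def sum.distrib flip: sum_distrib_left sum_divide_distrib)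
  also have "(\<Sum>i<n. a i) = P + E" by (simp add: a P_def E_def sum.distrib)
  also have "(\<Sum>i<n. (a i)\<^sup>2) = P2 + E2 + 2 * PE"
    by (simp add: a power2_sum sum.distrib P2_def E2_def PE_def sum_distrib_left mult_ac)
  finally have V: "V_hat n t X = ((N - 1) * ((K + P2 + 2 * PE) / 2) -
      ((P + E)\<^sup>2 - (P2 + E2 + 2 * PE)) / 2) / (N * (N - 1) / 2)"
    by (simp add: V_hat_def real_choose_two N_def)
  have "(\<Sum>i<n. 2 * (p i - sample_mean n p) / (real n - 1) * noise t (p i) (X i)) =
      2 / (N - 1) * (\<Sum>i<n. p i * e i - sample_mean n p * e i)"
    unfolding sum_distrib_left N_def e_def by (intro sum.cong refl) (simp flip: left_diff_distrib)
  also have "\<dots> = 2 / (N - 1) * (PE - P / N * E)"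
    unfolding sum_subtractf PE_def[symmetric] sum_distrib_left[symmetric] E_def[symmetric]
    by (simp add: P_def N_def sample_mean_def)
  finally have 1: "(\<Sum>i<n. 2 * (p i - sample_mean n p) / (real n - 1) * noise t (p i) (X i)) =
      2 / (N - 1) * (PE - P / N * E)" .
  have 2: "(\<Sum>i<n. 1 / real n * noise2 t (p i) (X i)) = K / N"
    by (simp add: K_def k_def N_def flip: sum_divide_distrib)
  have 3: "(\<Sum>j<n. \<Sum>i<j. noise t (p i) (X i) * noise t (p j) (X j)) = (E\<^sup>2 - E2) / 2"
    using sum_pairs_mult[of e n] by (simp add: e_def E_def E2_def)
  have 4: "sample_var n p = (P2 - P\<^sup>2 / N) / (N - 1)"
    using assms by (simp add: sample_var_def sum_sq_dev P2_def P_def N_def)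
  show ?thesis unfolding V 1 2 3 4 using N
    by (simp add: N_def[symmetric] divide_simps) algebra
qed

lemma sum_three_square_le: "(x + y - z)\<^sup>2 \<le> 3 * (x\<^sup>2 + y\<^sup>2 + z\<^sup>2)" for x y z :: real
proof -
  have "3 * (x\<^sup>2 + y\<^sup>2 + z\<^sup>2) - (x + y - z)\<^sup>2 = (x - y)\<^sup>2 + (x + z)\<^sup>2 + (y + z)\<^sup>2"
    by (simp add: power2_eq_square algebra_simps)
  then show ?thesis by (smt (verit) zero_le_power2)
qed

lemma sum_two_square_le: "(x - y)\<^sup>2 \<le> 2 * (x\<^sup>2 + y\<^sup>2)" for x y :: real
proof -
  have "2 * (x\<^sup>2 + y\<^sup>2) - (x - y)\<^sup>2 = (x + y)\<^sup>2"
    by (simp add: power2_eq_square algebra_simps)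
  then show ?thesis by (smt (verit) zero_le_power2)
qed

lemma product_weights_binomial:
  "(\<And>i. i < n \<Longrightarrow> 0 \<le> p i \<and> p i \<le> 1) \<Longrightarrow> product_weights n t (\<lambda>i. bin_weight t (p i))"
  by standard (auto simp: bin_weight_nonneg sum_bin_weight)

lemma pexp_noise_pairs_square:
  assumes n: "2 \<le> n" and t: "2 \<le> t" and p: "\<And>i. i < n \<Longrightarrow> 0 \<le> p i \<and> p i \<le> 1"
    and u: "\<And>i. i < n \<Longrightarrow> p i * (1 - p i) \<le> u"
  shows "pexp n t (\<lambda>i. bin_weight t (p i)) (\<lambda>X. (2 / (real n * (real n - 1)) *
      (\<Sum>j<n. \<Sum>i<j. noise t (p i) (X i) * noise t (p j) (X j)))\<^sup>2) \<le> 2 * u\<^sup>2 / (real n * (real t)\<^sup>2)"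
proof -
  interpret product_weights n t "\<lambda>i. bin_weight t (p i)"
    using p by (rule product_weights_binomial)
  define N where "N = real n"
  have N: "2 \<le> N" using n by (simp add: N_def)
  define v where "v i = p i * (1 - p i)" for i
  have v: "0 \<le> v i" "v i \<le> u" if "i < n" for i using p[OF that] u[OF that] by (auto simp: v_def)
  have t0: "0 < real t" using t by simp
  have u0: "0 \<le> u" using v[of 0] n by auto
  have "pexp n t (\<lambda>i. bin_weight t (p i)) (\<lambda>X. (2 / (real n * (real n - 1)) *
      (\<Sum>j<n. \<Sum>i<j. noise t (p i) (X i) * noise t (p j) (X j)))\<^sup>2) =
      (2 / (N * (N - 1)))\<^sup>2 * pexp n t (\<lambda>i. bin_weight t (p i)) (\<lambda>X.
      (\<Sum>j<n. \<Sum>i<j. noise t (p i) (X i) * noise t (p j) (X j))\<^sup>2)"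
    unfolding power_mult_distrib pexp_cmult N_def ..
  also have "pexp n t (\<lambda>i. bin_weight t (p i)) (\<lambda>X.
      (\<Sum>j<n. \<Sum>i<j. noise t (p i) (X i) * noise t (p j) (X j))\<^sup>2) = (\<Sum>j<n. \<Sum>i<j. v i / t * (v j / t))"
    using t by (subst pexp_quadratic_square) (simp_all add: noise_mean noise_square v_def)
  also have "\<dots> \<le> (\<Sum>j<n. \<Sum>i<j. u / t * (u / t))"
    using v t0 u0 by (intro sum_mono mult_mono divide_right_mono) auto
  also have "\<dots> = N * (N - 1) / 2 * (u / t * (u / t))"
    by (simp only: sum_pairs_const N_def)
  also have "(2 / (N * (N - 1)))\<^sup>2 * \<dots> = 2 * u\<^sup>2 / (N * real t ^ 2) / (N - 1)"
    using N t0 by (simp add: divide_simps power2_eq_square)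
  also have "\<dots> \<le> 2 * u\<^sup>2 / (N * real t ^ 2) / 1"
    using N t0 by (intro divide_left_mono) auto
  finally show ?thesis by (simp add: N_def mult_left_mono)
qed

text \<open>One bound for both uses: under the null the sample variance vanishes and
  \<open>u = p * (1 - p)\<close>; under the alternative \<open>u = 1 / 4\<close>.\<close>

lemma V_hat_second_moment:
  assumes n: "2 \<le> n" and t: "2 \<le> t" and p: "\<And>i. i < n \<Longrightarrow> 0 \<le> p i \<and> p i \<le> 1"
    and u: "\<And>i. i < n \<Longrightarrow> p i * (1 - p i) \<le> u"
  shows "pexp n t (\<lambda>i. bin_weight t (p i)) (\<lambda>X. (V_hat n t X - sample_var n p)\<^sup>2) \<le>
    24 * u * sample_var n p / (real n * real t) + 18 * u\<^sup>2 / (real n * (real t)\<^sup>2)"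
proof -
  interpret product_weights n t "\<lambda>i. bin_weight t (p i)"
    using p by (rule product_weights_binomial)
  define N where "N = real n"
  define T where "T = real t"
  have N: "2 \<le> N" and T: "2 \<le> T" using n t by (auto simp: N_def T_def)
  define v where "v i = p i * (1 - p i)" for i
  have v: "0 \<le> v i" "v i \<le> u" if "i < n" for i using p[OF that] u[OF that] by (auto simp: v_def)
  have u0: "0 \<le> u" using v[of 0] n by auto
  let ?E = "pexp n t (\<lambda>i. bin_weight t (p i))"
  define d where "d i = p i - sample_mean n p" for i
  define L where "L X = (\<Sum>i<n. 2 * d i / (N - 1) * noise t (p i) (X i))" for X
  define K where "K X = (\<Sum>i<n. 1 / N * noise2 t (p i) (X i))" for X
  define Q where "Q X = 2 / (N * (N - 1)) * (\<Sum>j<n. \<Sum>i<j. noise t (p i) (X i) * noise t (p j) (X j))" for X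
  have dec: "V_hat n t X - sample_var n p = L X + K X - Q X" for X
    using V_hat_decomposition[OF n t, of X p] by (simp add: L_def K_def Q_def d_def N_def)
  have "?E (\<lambda>X. (V_hat n t X - sample_var n p)\<^sup>2) \<le> ?E (\<lambda>X. 3 * ((L X)\<^sup>2 + (K X)\<^sup>2 + (Q X)\<^sup>2))"
    unfolding dec by (intro pexp_mono sum_three_square_le)
  also have "\<dots> = 3 * (?E (\<lambda>X. (L X)\<^sup>2) + ?E (\<lambda>X. (K X)\<^sup>2) + ?E (\<lambda>X. (Q X)\<^sup>2))"
    by (simp add: pexp_cmult pexp_add)
  also have "\<dots> \<le> 3 * (8 * u * sample_var n p / (N * T) + 4 * u\<^sup>2 / (N * T\<^sup>2) + 2 * u\<^sup>2 / (N * T\<^sup>2))"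
  proof (intro mult_left_mono add_mono)
    have "?E (\<lambda>X. (L X)\<^sup>2) = (\<Sum>i<n. (2 * d i / (N - 1))\<^sup>2 * (v i / T))"
      unfolding L_def using t
      by (subst pexp_linear_square)
         (simp_all only: power_mult_distrib mexp_cmult noise_mean noise_square v_def T_def)
    also have "\<dots> \<le> (\<Sum>i<n. (2 * d i / (N - 1))\<^sup>2 * (u / T))"
      using v T by (intro sum_mono mult_left_mono divide_right_mono) auto
    also have "\<dots> = 4 * u / T / (N - 1) * sample_var n p"
    proof -
      have "(\<Sum>i<n. (2 * d i / (N - 1))\<^sup>2 * (u / T)) = (\<Sum>i<n. (4 * u / T / (N - 1)\<^sup>2) * (d i)\<^sup>2)"
        by (intro sum.cong refl) (simp add: power_divide power_mult_distrib mult_ac)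
      also have "\<dots> = (4 * u / T / (N - 1)\<^sup>2) * (\<Sum>i<n. (d i)\<^sup>2)"
        by (simp add: sum_distrib_left)
      also have "\<dots> = 4 * u / T / (N - 1) * sample_var n p"
        by (simp add: sample_var_def d_def N_def power2_eq_square)
      finally show ?thesis .
    qed
    also have "\<dots> \<le> 4 * u / T / (N / 2) * sample_var n p"
      using N T u0
      by (intro mult_right_mono divide_left_mono)
         (auto simp: sample_var_def N_def[symmetric] intro!: divide_nonneg_nonneg sum_nonneg)
    finally show "?E (\<lambda>X. (L X)\<^sup>2) \<le> 8 * u * sample_var n p / (N * T)" by (simp add: mult_ac)
  next
    have "?E (\<lambda>X. (K X)\<^sup>2) = (\<Sum>i<n. (1 / N)\<^sup>2 * (2 * (v i)\<^sup>2 / (T * (T - 1))))"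
      unfolding K_def using t
      by (subst pexp_linear_square)
         (simp_all only: power_mult_distrib mexp_cmult noise2_mean noise2_square v_def T_def)
    also have "\<dots> \<le> (\<Sum>i<n. (1 / N)\<^sup>2 * (2 * u\<^sup>2 / (T * (T / 2))))"
      using v T N by (intro sum_mono mult_left_mono frac_le power_mono) auto
    also have "\<dots> = 4 * u\<^sup>2 / (N * T\<^sup>2)"
      using N T by (simp add: N_def[symmetric] power2_eq_square field_simps)
    finally show "?E (\<lambda>X. (K X)\<^sup>2) \<le> 4 * u\<^sup>2 / (N * T\<^sup>2)" .
  next
    show "?E (\<lambda>X. (Q X)\<^sup>2) \<le> 2 * u\<^sup>2 / (N * T\<^sup>2)"
      using pexp_noise_pairs_square[OF n t p u] by (simp add: Q_def N_def T_def)
  qed auto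
  also have "\<dots> = 24 * u * sample_var n p / (N * T) + 18 * u\<^sup>2 / (N * T\<^sup>2)"
    by (simp add: field_simps)
  finally show ?thesis by (simp add: N_def T_def)
qed

lemma mu_hat_decomposition:
  assumes "2 \<le> n"
  shows "mu_hat n t Y - p * (1 - p) = (\<Sum>i<n. (1 - 2 * p) / real n * noise t p (Y i))
    - 2 / (real n * (real n - 1)) * (\<Sum>j<n. \<Sum>i<j. noise t p (Y i) * noise t p (Y j))"
proof -
  define N where "N = real n"
  have N: "N \<noteq> 0" "N - 1 \<noteq> 0" using assms by (auto simp: N_def)
  define e where "e i = noise t p (Y i)" for i
  define a where "a i = real (Y i) / real t" for i
  have a: "a i = p + e i" for i by (simp add: a_def e_def noise_def)
  define E where "E = (\<Sum>i<n. e i)"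
  define E2 where "E2 = (\<Sum>i<n. (e i)\<^sup>2)"
  have "(\<Sum>j<n. \<Sum>i<j. h_tilde t (Y i) (Y j) / 2) = (\<Sum>j<n. \<Sum>i<j. (a i / 2 + a j / 2) - a i * a j)"
    by (intro sum.cong refl) (simp add: h_tilde_def a_def field_simps power2_eq_square)
  also have "\<dots> = (N - 1) * (\<Sum>i<n. a i / 2) - ((\<Sum>i<n. a i)\<^sup>2 - (\<Sum>i<n. (a i)\<^sup>2)) / 2"
    by (simp only: sum_subtractf sum_pairs_mult sum_pairs_add N_def)
  also have "(\<Sum>i<n. a i / 2) = (N * p + E) / 2"
    by (simp add: a E_def N_def sum.distrib flip: sum_divide_distrib)
  also have "(\<Sum>i<n. a i) = N * p + E" by (simp add: a N_def E_def sum.distrib)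
  also have "(\<Sum>i<n. (a i)\<^sup>2) = N * p\<^sup>2 + E2 + 2 * p * E"
    by (simp add: a power2_sum sum.distrib E2_def E_def N_def sum_distrib_left mult_ac)
  finally have V: "mu_hat n t Y = ((N - 1) * ((N * p + E) / 2) -
      ((N * p + E)\<^sup>2 - (N * p\<^sup>2 + E2 + 2 * p * E)) / 2) / (N * (N - 1) / 2)"
    by (simp add: mu_hat_def real_choose_two N_def)
  have 1: "(\<Sum>i<n. (1 - 2 * p) / real n * noise t p (Y i)) = (1 - 2 * p) / N * E"
    by (simp add: E_def e_def N_def sum_distrib_left)
  have 3: "(\<Sum>j<n. \<Sum>i<j. noise t p (Y i) * noise t p (Y j)) = (E\<^sup>2 - E2) / 2"
    using sum_pairs_mult[of e n] by (simp add: e_def E_def E2_def)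
  show ?thesis unfolding V 1 3 using N
    by (simp add: N_def[symmetric] divide_simps) algebra
qed

lemma mu_hat_second_moment:
  assumes n: "2 \<le> n" and t: "2 \<le> t" and p: "0 \<le> p" "p \<le> 1"
  shows "pexp n t (\<lambda>_. bin_weight t p) (\<lambda>Y. (mu_hat n t Y - p * (1 - p))\<^sup>2) \<le>
    4 * (p * (1 - p)) / real n"
proof -
  interpret product_weights n t "\<lambda>_. bin_weight t p"
    using p by (intro product_weights_binomial) auto
  define N where "N = real n"
  define T where "T = real t"
  have N: "2 \<le> N" and T: "2 \<le> T" using n t by (auto simp: N_def T_def)
  define v where "v = p * (1 - p)"
  have v: "0 \<le> v" "v \<le> 1" using p by (auto simp: v_def intro: mult_le_one)
  let ?E = "pexp n t (\<lambda>_. bin_weight t p)"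
  define L where "L X = (\<Sum>i<n. (1 - 2 * p) / N * noise t p (X i))" for X
  define Q where "Q X = 2 / (N * (N - 1)) * (\<Sum>j<n. \<Sum>i<j. noise t p (X i) * noise t p (X j))" for X
  have dec: "mu_hat n t X - v = L X - Q X" for X
    using mu_hat_decomposition[OF n, of t X p] by (simp add: L_def Q_def N_def v_def)
  have "?E (\<lambda>X. (mu_hat n t X - v)\<^sup>2) \<le> ?E (\<lambda>X. 2 * ((L X)\<^sup>2 + (Q X)\<^sup>2))"
    unfolding dec by (intro pexp_mono sum_two_square_le)
  also have "\<dots> = 2 * (?E (\<lambda>X. (L X)\<^sup>2) + ?E (\<lambda>X. (Q X)\<^sup>2))"
    by (simp add: pexp_cmult pexp_add)
  also have "\<dots> \<le> 2 * (v / N + v / N)"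
  proof (intro mult_left_mono add_mono)
    have "?E (\<lambda>X. (L X)\<^sup>2) = (\<Sum>i<n. ((1 - 2 * p) / N)\<^sup>2 * (v / T))"
      unfolding L_def using t
      by (subst pexp_linear_square)
         (simp_all only: power_mult_distrib mexp_cmult noise_mean noise_square v_def T_def)
    also have "\<dots> = (1 - 2 * p)\<^sup>2 * (v / T) / N"
      using N by (simp add: N_def[symmetric] power2_eq_square mult_ac)
    also have "\<dots> \<le> 1 * (v / 1) / N"
      using v T N p by (intro divide_right_mono mult_mono divide_left_mono)
        (auto simp: abs_square_le_1)
    finally show "?E (\<lambda>X. (L X)\<^sup>2) \<le> v / N" by simp
  next
    have "?E (\<lambda>X. (Q X)\<^sup>2) \<le> 2 * v\<^sup>2 / (N * T\<^sup>2)"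
      using pexp_noise_pairs_square[OF n t, of "\<lambda>_. p" v] p by (simp add: Q_def N_def T_def v_def)
    also have "\<dots> \<le> 2 * v / (N * 2)"
    proof (rule frac_le)
      have "v * v \<le> v * 1" using v by (intro mult_left_mono) auto
      then show "2 * v\<^sup>2 \<le> 2 * v" by (simp add: power2_eq_square)
      have "1 * 2 \<le> T * T" using T by (intro mult_mono) auto
      then show "N * 2 \<le> N * T\<^sup>2" using N by (simp add: power2_eq_square)
    qed (use N v in auto)
    finally show "?E (\<lambda>X. (Q X)\<^sup>2) \<le> v / N" by simp
  qed auto
  finally show ?thesis by (simp add: N_def v_def)
qed

section \<open>Samples from a binomial mixture\<close>

text \<open>Mixing distributions are measures on the whole real line. Clipping the success probability to
  [0,1] changes nothing almost everywhere and keeps all binomial weights nonnegative.\<close>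

definition clip :: "real \<Rightarrow> real" where
  "clip p = max 0 (min 1 p)"

lemma clip_bounds [simp]: "0 \<le> clip p" "clip p \<le> 1"
  by (auto simp: clip_def)

lemma clip_id: "p \<in> {0..1} \<Longrightarrow> clip p = p"
  by (auto simp: clip_def)

lemma measurable_clip [measurable]: "clip \<in> borel_measurable borel"
  unfolding clip_def by measurable

lemma measurable_bin_weight [measurable]: "(\<lambda>p. bin_weight t (clip p) j) \<in> borel_measurable borel"
  unfolding bin_weight_def by measurable

lemma bin_weight_le_1: "0 \<le> p \<Longrightarrow> p \<le> 1 \<Longrightarrow> j \<le> t \<Longrightarrow> bin_weight t p j \<le> 1"
  using member_le_sum[of j "{..t}" "bin_weight t p"] by (simp add: bin_weight_nonneg sum_bin_weight)

lemma mixing_distsD: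
  assumes "\<pi> \<in> mixing_dists"
  shows "prob_space \<pi>" "sets \<pi> = sets borel" "AE p in \<pi>. p \<in> {0..1}"
proof -
  show 1: "prob_space \<pi>" "sets \<pi> = sets borel" using assms by (auto simp: mixing_dists_def)
  interpret prob_space \<pi> by fact
  have "{0..1::real} \<in> events" using 1 by simp
  moreover have "prob {0..1} = 1" using assms by (auto simp: mixing_dists_def)
  ultimately show "AE p in \<pi>. p \<in> {0..1}" using prob_eq_1 by blast
qed

text \<open>The probability of the value \<open>j\<close> under the binomial mixture; the clipping is
  invisible to mixing distributions.\<close>

definition mix_weight :: "nat \<Rightarrow> real measure \<Rightarrow> nat \<Rightarrow> real" where
  "mix_weight t \<pi> j = (LINT p|\<pi>. bin_weight t (clip p) j)"

lemma integrable_bin_weight: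
  assumes "\<pi> \<in> mixing_dists" "j \<le> t"
  shows "integrable \<pi> (\<lambda>p. bin_weight t (clip p) j)"
proof -
  interpret prob_space \<pi> using mixing_distsD[OF assms(1)] by simp
  note [measurable_cong] = mixing_distsD(2)[OF assms(1)]
  show ?thesis
    by (rule integrable_const_bound[of _ 1])
       (auto simp: bin_weight_nonneg bin_weight_le_1 assms)
qed

lemma binomial_mixture_eq:
  assumes "\<pi> \<in> mixing_dists"
  shows "binomial_mixture t \<pi> = point_measure {..t} (\<lambda>j. ennreal (mix_weight t \<pi> j))"
proof -
  note [measurable_cong] = mixing_distsD(2)[OF assms]
  have "(LINT p|\<pi>. real (t choose j) * p ^ j * (1 - p) ^ (t - j)) = mix_weight t \<pi> j" for j
    unfolding mix_weight_def
  proof (rule integral_cong_AE)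
    show "AE p in \<pi>. real (t choose j) * p ^ j * (1 - p) ^ (t - j) = bin_weight t (clip p) j"
      using mixing_distsD(3)[OF assms] by eventually_elim (simp add: clip_id bin_weight_def)
  qed simp_all
  then show ?thesis by (simp add: binomial_mixture_def)
qed

lemma mix_weight_nonneg: "0 \<le> mix_weight t \<pi> j"
  by (simp add: mix_weight_def bin_weight_nonneg)

lemma sum_mix_weight:
  assumes "\<pi> \<in> mixing_dists"
  shows "(\<Sum>j\<le>t. mix_weight t \<pi> j) = 1"
proof -
  interpret prob_space \<pi> using mixing_distsD[OF assms] by simp
  have "(\<Sum>j\<le>t. mix_weight t \<pi> j) = (LINT p|\<pi>. (\<Sum>j\<le>t. bin_weight t (clip p) j))"
    unfolding mix_weight_def using integrable_bin_weight[OF assms] by (subst Bochner_Integration.integral_sum) auto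
  then show ?thesis by (simp add: sum_bin_weight prob_space)
qed

lemma product_weights_mix: "\<pi> \<in> mixing_dists \<Longrightarrow> product_weights n t (\<lambda>_. mix_weight t \<pi>)"
  by standard (auto simp: mix_weight_nonneg sum_mix_weight)

lemma prob_space_binomial_mixture:
  "\<pi> \<in> mixing_dists \<Longrightarrow> prob_space (binomial_mixture t \<pi>)"
  unfolding binomial_mixture_eq
  by (rule prob_space_point_measure) (auto simp: sum_mix_weight mix_weight_nonneg)

lemma space_sample: "space (sample n (binomial_mixture t \<pi>)) = {..<n} \<rightarrow>\<^sub>E {..t}"
  by (simp add: sample_def binomial_mixture_def space_PiM space_point_measure)

lemma prob_space_sample: "\<pi> \<in> mixing_dists \<Longrightarrow> prob_space (sample n (binomial_mixture t \<pi>))"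
  unfolding sample_def by (intro prob_space_PiM prob_space_binomial_mixture)

lemma
  assumes "\<pi> \<in> mixing_dists" "X \<in> {..<n} \<rightarrow>\<^sub>E {..t}"
  shows sets_sample_singleton: "{X} \<in> sets (sample n (binomial_mixture t \<pi>))"
    and measure_sample_singleton:
      "measure (sample n (binomial_mixture t \<pi>)) {X} = (\<Prod>i<n. mix_weight t \<pi> (X i))"
proof -
  let ?P = "binomial_mixture t \<pi>"
  interpret mix: prob_space ?P by (rule prob_space_binomial_mixture) fact
  interpret finite_product_prob_space "\<lambda>_. ?P" "{..<n}" by standard auto
  have sets_P: "sets ?P = Pow {..t}" by (simp add: binomial_mixture_def sets_point_measure)
  have X: "{X} = (\<Pi>\<^sub>E i\<in>{..<n}. {X i})"
    using assms by (subst PiE_singleton) (auto simp: PiE_iff)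
  have in_sets: "{X i} \<in> sets ?P" if "i < n" for i
    using assms that by (auto simp: sets_P PiE_iff)
  show "{X} \<in> sets (sample n ?P)"
    unfolding X sample_def by (rule sets_PiM_I_finite) (auto intro: in_sets)
  have P: "measure ?P {j} = mix_weight t \<pi> j" if "j \<le> t" for j
    using that by (simp add: binomial_mixture_eq assms measure_def emeasure_point_measure_finite mix_weight_nonneg)
  have "measure (sample n ?P) {X} = (\<Prod>i<n. measure ?P {X i})"
    unfolding X sample_def by (rule finite_measure_PiM_emb) (auto intro: in_sets)
  also have "\<dots> = (\<Prod>i<n. mix_weight t \<pi> (X i))"
    using assms by (intro prod.cong refl P) (auto simp: PiE_iff)
  finally show "measure (sample n ?P) {X} = (\<Prod>i<n. mix_weight t \<pi> (X i))" .
qed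

lemma sets_sample:
  assumes "\<pi> \<in> mixing_dists"
  shows "sets (sample n (binomial_mixture t \<pi>)) = Pow ({..<n} \<rightarrow>\<^sub>E {..t})"
proof (intro equalityI subsetI)
  fix A assume "A \<in> Pow ({..<n} \<rightarrow>\<^sub>E {..t})"
  then have A: "A \<subseteq> {..<n} \<rightarrow>\<^sub>E {..t}" "finite A"
    using finite_subset[OF _ finite_sample_space] by auto
  then have "(\<Union>X\<in>A. {X}) \<in> sets (sample n (binomial_mixture t \<pi>))"
    using sets_sample_singleton[OF assms] by (intro sets.finite_UN) auto
  then show "A \<in> sets (sample n (binomial_mixture t \<pi>))" by simp
next
  fix A assume "A \<in> sets (sample n (binomial_mixture t \<pi>))"
  from sets.sets_into_space[OF this] show "A \<in> Pow ({..<n} \<rightarrow>\<^sub>E {..t})"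
    by (simp add: space_sample)
qed

lemma measure_sample:
  assumes "\<pi> \<in> mixing_dists"
  shows "measure (sample n (binomial_mixture t \<pi>)) {X \<in> {..<n} \<rightarrow>\<^sub>E {..t}. P X} =
    pexp n t (\<lambda>_. mix_weight t \<pi>) (\<lambda>X. of_bool (P X))"
proof -
  let ?S = "{..<n} \<rightarrow>\<^sub>E {..t}"
  interpret prob_space "sample n (binomial_mixture t \<pi>)" by (rule prob_space_sample) fact
  have "prob {X \<in> ?S. P X} = (\<Sum>X\<in>{X \<in> ?S. P X}. prob {X})"
    by (rule finite_measure_eq_sum_singleton) (auto simp: sets_sample[OF assms] intro: finite_subset[OF _ finite_sample_space])
  also have "\<dots> = (\<Sum>X\<in>{X \<in> ?S. P X}. \<Prod>i<n. mix_weight t \<pi> (X i))"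
    using measure_sample_singleton[OF assms] by (intro sum.cong) auto
  also have "\<dots> = (\<Sum>X\<in>?S. if P X then \<Prod>i<n. mix_weight t \<pi> (X i) else 0)"
    by (subst sum.inter_filter) auto
  also have "\<dots> = pexp n t (\<lambda>_. mix_weight t \<pi>) (\<lambda>X. of_bool (P X))"
    unfolding pexp_def by (intro sum.cong) auto
  finally show ?thesis .
qed

lemma point_masses_subset: "point_masses \<subseteq> mixing_dists"
  by (auto simp: point_masses_def mixing_dists_def measure_return prob_space_return)

lemma mix_weight_return: "p \<in> {0..1} \<Longrightarrow> mix_weight t (return borel p) = bin_weight t p"
  by (rule ext) (simp add: mix_weight_def integral_return clip_id)

text \<open>A sample from the mixture arises by drawing \<open>n\<close> success probabilities
  independently from \<open>\<pi>\<close> and then one binomial observation for each of them.\<close>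

lemma mixture_of_products:
  assumes "\<pi> \<in> mixing_dists"
  shows "pexp n t (\<lambda>_. mix_weight t \<pi>) f =
      (LINT p|PiM {..<n} (\<lambda>_. \<pi>). pexp n t (\<lambda>i. bin_weight t (clip (p i))) f)"
    and "integrable (PiM {..<n} (\<lambda>_. \<pi>)) (\<lambda>p. pexp n t (\<lambda>i. bin_weight t (clip (p i))) f)"
proof -
  interpret mix: prob_space \<pi> using mixing_distsD[OF assms] by simp
  interpret product_prob_space "\<lambda>_. \<pi>" by standard
  have int: "integrable (PiM {..<n} (\<lambda>_. \<pi>)) (\<lambda>p. (\<Prod>i<n. bin_weight t (clip (p i)) (X i)))"
    if "X \<in> {..<n} \<rightarrow>\<^sub>E {..t}" for X
    using that by (intro product_integrable_prod integrable_bin_weight assms) (auto simp: PiE_iff)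
  show "integrable (PiM {..<n} (\<lambda>_. \<pi>)) (\<lambda>p. pexp n t (\<lambda>i. bin_weight t (clip (p i))) f)"
    unfolding pexp_def using int by auto
  have "(LINT p|PiM {..<n} (\<lambda>_. \<pi>). pexp n t (\<lambda>i. bin_weight t (clip (p i))) f) =
      (\<Sum>X\<in>{..<n} \<rightarrow>\<^sub>E {..t}. (LINT p|PiM {..<n} (\<lambda>_. \<pi>). (\<Prod>i<n. bin_weight t (clip (p i)) (X i))) * f X)"
    unfolding pexp_def using int by (subst Bochner_Integration.integral_sum) auto
  also have "\<dots> = (\<Sum>X\<in>{..<n} \<rightarrow>\<^sub>E {..t}. (\<Prod>i<n. mix_weight t \<pi> (X i)) * f X)"
  proof (intro sum.cong refl arg_cong2[where f = "(*)"])
    fix X assume X: "X \<in> {..<n} \<rightarrow>\<^sub>E {..t}"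
    show "(LINT p|PiM {..<n} (\<lambda>_. \<pi>). (\<Prod>i<n. bin_weight t (clip (p i)) (X i))) = (\<Prod>i<n. mix_weight t \<pi> (X i))"
      unfolding mix_weight_def using X
      by (intro product_integral_prod integrable_bin_weight assms) (auto simp: PiE_iff)
  qed
  finally show "pexp n t (\<lambda>_. mix_weight t \<pi>) f =
      (LINT p|PiM {..<n} (\<lambda>_. \<pi>). pexp n t (\<lambda>i. bin_weight t (clip (p i))) f)"
    by (simp add: pexp_def)
qed

section \<open>Wasserstein distance to the point masses\<close>

lemma integrable_bounded_mixing:
  fixes f :: "real \<Rightarrow> real"
  assumes "\<pi> \<in> mixing_dists" "f \<in> borel_measurable borel" "\<And>p. p \<in> {0..1} \<Longrightarrow> \<bar>f p\<bar> \<le> B"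
  shows "integrable \<pi> f"
proof -
  interpret prob_space \<pi> using mixing_distsD[OF assms(1)] by simp
  note [measurable_cong] = mixing_distsD(2)[OF assms(1)]
  note [measurable] = assms(2)
  have "AE p in \<pi>. norm (f p) \<le> B"
    using mixing_distsD(3)[OF assms(1)] by eventually_elim (simp add: assms)
  then show ?thesis by (rule integrable_const_bound) simp
qed

text \<open>Every coupling with a point mass has the same cost.\<close>

lemma coupling_cost_return:
  assumes \<Gamma>: "\<Gamma> \<in> couplings \<pi> (return borel s)"
  shows "(LINT z|\<Gamma>. \<bar>fst z - snd z\<bar>) = (LINT p|\<pi>. \<bar>p - s\<bar>)"
proof -
  have sets: "sets \<Gamma> = sets (borel \<Otimes>\<^sub>M borel)" and fst: "distr \<Gamma> borel fst = \<pi>"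
    and snd: "distr \<Gamma> borel snd = return borel s"
    using \<Gamma> by (auto simp: couplings_def)
  note [measurable_cong] = sets
  have "AE x in return borel s. x = s" by (subst AE_return) auto
  then have "AE x in distr \<Gamma> borel snd. x = s" by (simp only: snd)
  then have AE: "AE z in \<Gamma>. snd z = s" by (subst (asm) AE_distr_iff) auto
  have "(LINT z|\<Gamma>. \<bar>fst z - snd z\<bar>) = (LINT z|\<Gamma>. \<bar>fst z - s\<bar>)"
    using AE by (intro integral_cong_AE) auto
  also have "\<dots> = (LINT p|distr \<Gamma> borel fst. \<bar>p - s\<bar>)"
    by (subst integral_distr) auto
  finally show ?thesis by (simp add: fst)
qed

lemma return_coupling_exists:
  assumes "\<pi> \<in> mixing_dists"
  shows "couplings \<pi> (return borel s) \<noteq> {}"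
proof -
  interpret prob_space \<pi> using mixing_distsD[OF assms] by simp
  note [measurable_cong] = mixing_distsD(2)[OF assms]
  define \<Gamma> where "\<Gamma> = distr \<pi> (borel \<Otimes>\<^sub>M borel) (\<lambda>p. (p, s))"
  have "prob_space \<Gamma>" unfolding \<Gamma>_def by (rule prob_space_distr) measurable
  moreover have "distr \<Gamma> borel fst = \<pi>"
    unfolding \<Gamma>_def using mixing_distsD(2)[OF assms]
    by (subst distr_distr) (auto simp: comp_def intro: distr_id2)
  moreover have "distr \<Gamma> borel snd = return borel s"
    unfolding \<Gamma>_def by (subst distr_distr) (auto simp: comp_def)
  ultimately have "\<Gamma> \<in> couplings \<pi> (return borel s)"
    by (simp add: couplings_def \<Gamma>_def)
  then show ?thesis by auto
qed

lemma W1_return: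
  assumes "\<pi> \<in> mixing_dists"
  shows "W1 \<pi> (return borel s) = (LINT p|\<pi>. \<bar>p - s\<bar>)"
  unfolding W1_def using return_coupling_exists[OF assms]
  by (simp add: coupling_cost_return cong: INF_cong_simp)

lemma W1_set_point_masses_le:
  assumes "\<pi> \<in> mixing_dists" "s \<in> {0..1}"
  shows "W1_set \<pi> point_masses \<le> (LINT p|\<pi>. \<bar>p - s\<bar>)"
proof -
  have "W1_set \<pi> point_masses \<le> W1 \<pi> (return borel s)"
    unfolding W1_set_def
    by (rule cINF_lower) (use assms in \<open>auto simp: point_masses_def W1_return intro!: bdd_belowI2[where m=0]\<close>)
  then show ?thesis by (simp add: W1_return assms)
qed

lemma W1_set_point_masses_ge:
  assumes "\<pi> \<in> mixing_dists" "\<And>s. s \<in> {0..1} \<Longrightarrow> m \<le> (LINT p|\<pi>. \<bar>p - s\<bar>)"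
  shows "m \<le> W1_set \<pi> point_masses"
  unfolding W1_set_def by (rule cINF_greatest) (auto simp: point_masses_def W1_return assms)

text \<open>The distribution with mass \<open>w\<close> at \<open>x\<close> and mass
  \<open>1 - w\<close> at \<open>y\<close>.\<close>

definition two_point :: "real \<Rightarrow> real \<Rightarrow> real \<Rightarrow> real measure" where
  "two_point w x y = distr (measure_pmf (bernoulli_pmf w)) borel (\<lambda>b. if b then x else y)"

lemma integral_two_point:
  fixes f :: "real \<Rightarrow> real"
  assumes "f \<in> borel_measurable borel" "0 \<le> w" "w \<le> 1"
  shows "(LINT p|two_point w x y. f p) = w * f x + (1 - w) * f y"
  unfolding two_point_def using assms by (subst integral_distr) (auto simp: mult.commute)

lemma two_point_mixing:
  assumes "x \<in> {0..1}" "y \<in> {0..1}"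
  shows "two_point w x y \<in> mixing_dists"
proof -
  have "prob_space (two_point w x y)"
    unfolding two_point_def by (rule prob_space.prob_space_distr) (auto intro: measure_pmf.prob_space_axioms)
  moreover have "measure (two_point w x y) {0..1} = 1"
    unfolding two_point_def using assms
    by (subst measure_distr) (auto simp: vimage_def)
  ultimately show ?thesis by (simp add: mixing_dists_def two_point_def)
qed

section \<open>Lower bounds for the critical separation\<close>

lemma level_testsD:
  assumes "\<psi> \<in> level_tests \<alpha> n t point_masses" "p \<in> {0..1}"
  shows "pexp n t (\<lambda>_. bin_weight t p) (\<lambda>X. of_bool (\<psi> X = 1)) \<le> \<alpha>"
proof -
  let ?m = "\<lambda>\<pi>. measure (sample n (binomial_mixture t \<pi>))
        {X \<in> space (sample n (binomial_mixture t \<pi>)). \<psi> X = 1}"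
  have pm: "return borel p \<in> point_masses" using assms by (auto simp: point_masses_def)
  have "bdd_above (?m ` point_masses)"
    using point_masses_subset by (auto intro!: bdd_aboveI2[where M=1] prob_space.prob_le_1 prob_space_sample)
  then have "?m (return borel p) \<le> (SUP \<pi>\<in>point_masses. ?m \<pi>)" by (rule cSUP_upper[OF pm])
  also have "\<dots> \<le> \<alpha>" using assms by (simp add: level_tests_def)
  finally have "pexp n t (\<lambda>_. mix_weight t (return borel p)) (\<lambda>X. of_bool (\<psi> X = 1)) \<le> \<alpha>"
    using measure_sample[of "return borel p" n t] pm point_masses_subset by (simp add: space_sample subset_eq)
  then show ?thesis by (simp only: mix_weight_return[OF assms(2)])
qed

lemma type_II_le_worst:
  assumes "\<pi> \<in> mixing_dists" "\<epsilon> \<le> W1_set \<pi> S"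
  shows "measure (sample n (binomial_mixture t \<pi>)) {X \<in> space (sample n (binomial_mixture t \<pi>)). \<psi> X = 0}
    \<le> worst_type_II n t \<epsilon> S \<psi>"
  unfolding worst_type_II_def
  by (rule cSup_upper)
     (use assms in \<open>auto intro!: bdd_aboveI[where M=1] prob_space.prob_le_1 prob_space_sample\<close>)

lemma worst_type_II_nonneg: "0 \<le> worst_type_II n t \<epsilon> S \<psi>"
  unfolding worst_type_II_def
  by (rule cSup_upper) (auto intro!: bdd_aboveI[where M=1] prob_space.prob_le_1 prob_space_sample)

lemma trivial_test: "0 \<le> \<alpha> \<Longrightarrow> (\<lambda>_. 0) \<in> level_tests \<alpha> n t point_masses"
  unfolding level_tests_def by (auto simp: point_masses_def)

text \<open>It suffices to find, for every level test, one alternative at distance at least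
  \<open>L\<close> that the test misses with probability at least \<open>b\<close>. The margin
  \<open>\<beta> < b\<close> is needed since the minimax risk is an infimum over tests. The
  separation 2 exceeds all distances, which makes the set of admissible separations nonempty.\<close>

lemma critical_separation_ge:
  assumes "0 \<le> \<alpha>" "0 \<le> \<beta>" "\<beta> < b"
    and hard: "\<And>\<psi>. \<psi> \<in> level_tests \<alpha> n t point_masses \<Longrightarrow> \<exists>\<pi>\<in>mixing_dists.
      L \<le> W1_set \<pi> point_masses \<and> b \<le> pexp n t (\<lambda>_. mix_weight t \<pi>) (\<lambda>X. of_bool (\<psi> X = 0))"
  shows "L \<le> critical_separation \<alpha> \<beta> n t point_masses"
  unfolding critical_separation_def
proof (rule cInf_greatest)
  have "{\<pi> \<in> mixing_dists. 2 \<le> W1_set \<pi> point_masses} = {}"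
  proof safe
    fix \<pi> assume \<pi>: "\<pi> \<in> mixing_dists" "2 \<le> W1_set \<pi> point_masses"
    interpret prob_space \<pi> using mixing_distsD[OF \<pi>(1)] by simp
    have "W1_set \<pi> point_masses \<le> (LINT p|\<pi>. \<bar>p - 0\<bar>)"
      using \<pi> by (intro W1_set_point_masses_le) auto
    also have "\<dots> \<le> (LINT p|\<pi>. 1)"
      using mixing_distsD(3)[OF \<pi>(1)] \<pi>(1)
      by (intro integral_mono_AE integrable_bounded_mixing[where B=1]) auto
    finally show "\<pi> \<in> {}" using \<pi> by (simp add: prob_space)
  qed
  then have "worst_type_II n t 2 point_masses (\<lambda>_. 0) = 0"
    by (simp only: worst_type_II_def) simp
  moreover have "minimax_risk \<alpha> n t 2 point_masses \<le> worst_type_II n t 2 point_masses (\<lambda>_. 0)"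
    unfolding minimax_risk_def
    by (rule cINF_lower) (auto intro!: bdd_belowI2[where m=0] worst_type_II_nonneg trivial_test assms)
  ultimately have "minimax_risk \<alpha> n t 2 point_masses \<le> \<beta>" using assms by simp
  then show "{\<epsilon>. minimax_risk \<alpha> n t \<epsilon> point_masses \<le> \<beta>} \<noteq> {}" by blast
next
  fix \<epsilon> assume \<epsilon>: "\<epsilon> \<in> {\<epsilon>. minimax_risk \<alpha> n t \<epsilon> point_masses \<le> \<beta>}"
  show "L \<le> \<epsilon>"
  proof (rule ccontr)
    assume "\<not> L \<le> \<epsilon>"
    have "b \<le> minimax_risk \<alpha> n t \<epsilon> point_masses"
      unfolding minimax_risk_def
    proof (rule cINF_greatest)
      show "level_tests \<alpha> n t point_masses \<noteq> {}" using trivial_test assms by blast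
      fix \<psi> assume "\<psi> \<in> level_tests \<alpha> n t point_masses"
      then obtain \<pi> where \<pi>: "\<pi> \<in> mixing_dists" "L \<le> W1_set \<pi> point_masses"
        "b \<le> pexp n t (\<lambda>_. mix_weight t \<pi>) (\<lambda>X. of_bool (\<psi> X = 0))"
        using hard by blast
      have "b \<le> measure (sample n (binomial_mixture t \<pi>)) {X \<in> space (sample n (binomial_mixture t \<pi>)). \<psi> X = 0}"
        using \<pi> measure_sample[of \<pi> n t] by (simp add: space_sample)
      also have "\<dots> \<le> worst_type_II n t \<epsilon> point_masses \<psi>"
        using \<pi> \<open>\<not> L \<le> \<epsilon>\<close> by (intro type_II_le_worst) auto
      finally show "b \<le> worst_type_II n t \<epsilon> point_masses \<psi>" .
    qed
    then show False using \<epsilon> assms by auto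
  qed
qed

lemma type_II_eq:
  assumes "\<pi> \<in> mixing_dists" "\<psi> \<in> level_tests \<alpha> n t S"
  shows "pexp n t (\<lambda>_. mix_weight t \<pi>) (\<lambda>X. of_bool (\<psi> X = 0)) =
    1 - pexp n t (\<lambda>_. mix_weight t \<pi>) (\<lambda>X. of_bool (\<psi> X = 1))"
proof -
  interpret product_weights n t "\<lambda>_. mix_weight t \<pi>" by (rule product_weights_mix) fact
  have "pexp n t (\<lambda>_. mix_weight t \<pi>) (\<lambda>X. of_bool (\<psi> X = 0)) +
      pexp n t (\<lambda>_. mix_weight t \<pi>) (\<lambda>X. of_bool (\<psi> X = 1)) = pexp n t (\<lambda>_. mix_weight t \<pi>) (\<lambda>_. 1)"
    unfolding pexp_add[symmetric] using assms(2)
    by (intro pexp_cong) (auto simp: level_tests_def Pi_iff)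
  then show ?thesis by (simp add: pexp_const)
qed

text \<open>The point mass at 0 against a mixture that puts mass of order \<open>1 / n\<close> at 1:
  with probability bounded below the sample is all zero, and then every level test accepts.\<close>

lemma critical_separation_ge_inverse_n:
  assumes \<alpha>: "0 \<le> \<alpha>" "\<alpha> < 1" and \<beta>: "0 \<le> \<beta>" "\<beta> < 1" and n: "1 \<le> n" and t: "1 \<le> t"
  shows "(1 - \<beta>) / (2 * real n) \<le> critical_separation \<alpha> \<beta> n t point_masses"
proof (rule critical_separation_ge)
  show "\<beta> < (1 + \<beta>) / 2" using \<beta> by simp
  define w where "w = (1 - \<beta>) / (2 * real n)"
  have w: "0 \<le> w" "w \<le> 1 / 2" using n \<beta> by (auto simp: w_def field_simps)
  let ?\<pi> = "two_point w 1 0"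
  have \<pi>: "?\<pi> \<in> mixing_dists" by (rule two_point_mixing) auto
  fix \<psi> assume \<psi>: "\<psi> \<in> level_tests \<alpha> n t point_masses"
  have "w \<le> W1_set ?\<pi> point_masses"
  proof (rule W1_set_point_masses_ge[OF \<pi>])
    fix s :: real assume s: "s \<in> {0..1}"
    have "0 \<le> s * (1 - 2 * w)" using s w by simp
    then show "w \<le> (LINT p|?\<pi>. \<bar>p - s\<bar>)"
      using w s by (simp add: integral_two_point algebra_simps)
  qed
  moreover have "(1 + \<beta>) / 2 \<le> pexp n t (\<lambda>_. mix_weight t ?\<pi>) (\<lambda>X. of_bool (\<psi> X = 0))"
  proof -
    define x0 where "x0 = (\<lambda>i\<in>{..<n}. 0::nat)"
    have x0: "x0 \<in> {..<n} \<rightarrow>\<^sub>E {..t}" by (auto simp: x0_def)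
    interpret N: product_weights n t "\<lambda>_. bin_weight t 0" by (rule product_weights_binomial) auto
    interpret A: product_weights n t "\<lambda>_. mix_weight t ?\<pi>" by (rule product_weights_mix) fact
    \<comment> \<open>the all-zero sample has probability one under the point mass at 0, so it is accepted\<close>
    have "\<psi> x0 \<noteq> 1"
    proof
      assume "\<psi> x0 = 1"
      have "1 = (\<Prod>i<n. bin_weight t 0 (x0 i)) * of_bool (\<psi> x0 = 1)"
        using \<open>\<psi> x0 = 1\<close> by (simp add: x0_def bin_weight_def)
      also have "\<dots> \<le> pexp n t (\<lambda>_. bin_weight t 0) (\<lambda>X. of_bool (\<psi> X = 1))"
        unfolding pexp_def by (rule member_le_sum[OF x0]) (auto simp: N.weight_nonneg)
      also have "\<dots> \<le> \<alpha>" using level_testsD[OF \<psi>, of 0] by simp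
      finally show False using \<alpha> by simp
    qed
    then have acc: "\<psi> x0 = 0" using \<psi> x0 by (auto simp: level_tests_def Pi_iff)
    have mw: "mix_weight t ?\<pi> 0 = 1 - w"
      unfolding mix_weight_def using w t
      by (subst integral_two_point) (auto simp: bin_weight_def clip_def)
    have "(1 + \<beta>) / 2 = 1 + real n * (- w)" using n by (simp add: w_def field_simps)
    also have "\<dots> \<le> (1 + (- w)) ^ n" using w by (intro Bernoulli_inequality) auto
    also have "\<dots> = (\<Prod>i<n. mix_weight t ?\<pi> (x0 i)) * of_bool (\<psi> x0 = 0)"
      using acc by (simp add: x0_def mw)
    also have "\<dots> \<le> pexp n t (\<lambda>_. mix_weight t ?\<pi>) (\<lambda>X. of_bool (\<psi> X = 0))"
      unfolding pexp_def by (rule member_le_sum[OF x0]) (auto simp: A.weight_nonneg)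
    finally show ?thesis .
  qed
  ultimately show "\<exists>\<pi>\<in>mixing_dists. (1 - \<beta>) / (2 * real n) \<le> W1_set \<pi> point_masses \<and>
      (1 + \<beta>) / 2 \<le> pexp n t (\<lambda>_. mix_weight t \<pi>) (\<lambda>X. of_bool (\<psi> X = 0))"
    using \<pi> by (auto simp: w_def)
qed (use \<alpha> \<beta> in auto)

lemma average_exp_le:
  fixes y :: real
  assumes "0 \<le> y" "y \<le> 1"
  shows "(exp y + exp (- y)) / 2 \<le> 1 + y\<^sup>2"
proof -
  have "exp y \<le> 1 + y + y\<^sup>2" using assms by (intro exp_bound) auto
  moreover have "exp (- y) \<le> 1 - y + y\<^sup>2"
  proof -
    have "exp (- y) = 1 / exp y" by (simp add: exp_minus inverse_eq_divide)
    also have "\<dots> \<le> 1 / (1 + y)" using assms exp_ge_add_one_self[of y] by (intro divide_left_mono) auto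
    also have "\<dots> \<le> 1 - y + y\<^sup>2"
    proof -
      have "1 \<le> (1 - y + y\<^sup>2) * (1 + y)"
        using assms by (simp add: power2_eq_square algebra_simps)
      then show ?thesis using assms by (simp add: divide_le_eq)
    qed
    finally show ?thesis .
  qed
  ultimately show ?thesis by simp
qed

text \<open>The point mass at 1/2 against the symmetric two-point mixture at \<open>1 / 2 - s\<close>
  and \<open>1 / 2 + s\<close>. The chi-square distance of one observation is at most
  \<open>(4 * s\<^sup>2 * t)\<^sup>2\<close> when
  \<open>4 * s\<^sup>2 * t \<le> 1\<close>, so \<open>n\<close> observations do not
  separate the two when \<open>s\<^sup>2\<close> is a small multiple of
  \<open>1 / (t * sqrt n)\<close>.\<close>

lemma critical_separation_ge_local:
  assumes \<alpha>: "0 \<le> \<alpha>" and \<beta>: "0 \<le> \<beta>" "\<beta> < 1 - \<alpha>" and n: "1 \<le> n" and t: "1 \<le> t"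
  shows "sqrt ((1 - \<alpha> - \<beta>) / 12 / (real t * sqrt (real n))) \<le> critical_separation \<alpha> \<beta> n t point_masses"
proof (rule critical_separation_ge)
  define \<kappa> where "\<kappa> = (1 - \<alpha> - \<beta>) / 12"
  have \<kappa>: "0 < \<kappa>" "\<kappa> \<le> 1 / 12" using \<alpha> \<beta> by (auto simp: \<kappa>_def)
  show "\<beta> < 1 - \<alpha> - 6 * \<kappa>" using \<beta> by (simp add: \<kappa>_def field_simps)
  define s where "s = sqrt (\<kappa> / (real t * sqrt (real n)))"
  have tn: "1 \<le> real t * sqrt (real n)"
    using n t mult_mono[of 1 "real t" 1 "sqrt (real n)"] by simp
  have s2: "s\<^sup>2 = \<kappa> / (real t * sqrt (real n))"
    unfolding s_def using \<kappa> tn by (intro real_sqrt_pow2 divide_nonneg_nonneg) auto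
  have "s\<^sup>2 \<le> \<kappa> / 1" unfolding s2 using \<kappa> tn by (intro divide_left_mono) auto
  then have "s\<^sup>2 \<le> (1 / 2)\<^sup>2" using \<kappa> by (simp add: power2_eq_square)
  then have s: "0 \<le> s" "s \<le> 1 / 2"
    using \<kappa> tn power2_le_imp_le[of s "1/2"] by (auto simp: s_def)
  let ?\<pi> = "two_point (1/2) (1/2 + s) (1/2 - s)"
  have \<pi>: "?\<pi> \<in> mixing_dists" by (rule two_point_mixing) (use s in auto)
  fix \<psi> assume \<psi>: "\<psi> \<in> level_tests \<alpha> n t point_masses"
  have "s \<le> W1_set ?\<pi> point_masses"
  proof (rule W1_set_point_masses_ge[OF \<pi>])
    fix r :: real assume "r \<in> {0..1}"
    show "s \<le> (LINT p|?\<pi>. \<bar>p - r\<bar>)"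
      using abs_ge_self[of "1/2 + s - r"] abs_ge_minus_self[of "1/2 - s - r"]
      by (simp add: integral_two_point)
  qed
  moreover have "1 - \<alpha> - 6 * \<kappa> \<le> pexp n t (\<lambda>_. mix_weight t ?\<pi>) (\<lambda>X. of_bool (\<psi> X = 0))"
  proof -
    let ?E = "pexp n t (\<lambda>_. bin_weight t (1/2))"
    interpret N: product_weights n t "\<lambda>_. bin_weight t (1/2)" by (rule product_weights_binomial) auto
    define a where "a = 1 + 2 * s"
    define b where "b = 1 - 2 * s"
    \<comment> \<open>likelihood ratio of one observation\<close>
    define r where "r j = (a ^ j * b ^ (t - j) + b ^ j * a ^ (t - j)) / 2" for j
    have mix: "mix_weight t ?\<pi> j = bin_weight t (1/2) j * r j" if "j \<le> t" for j
    proof -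
      have "mix_weight t ?\<pi> j = bin_weight t (a / 2) j / 2 + bin_weight t (b / 2) j / 2"
        unfolding mix_weight_def using s
        by (subst integral_two_point) (auto simp: clip_id a_def b_def add_divide_distrib diff_divide_distrib)
      also have "\<dots> = real (t choose j) * (a / 2) ^ j * (b / 2) ^ (t - j) / 2 +
          real (t choose j) * (b / 2) ^ j * (a / 2) ^ (t - j) / 2"
        by (simp add: bin_weight_def a_def b_def field_simps)
      also have "\<dots> = bin_weight t (1/2) j * r j"
        by (simp add: bin_weight_def r_def power_divide field_simps)
      finally show ?thesis .
    qed
    have gen: "mexp t (bin_weight t (1/2)) (\<lambda>j. x ^ j * y ^ (t - j)) = ((x + y) / 2) ^ t" for x y :: real
      using binomial_ring[of "x / 2" "y / 2" t]
      by (simp add: mexp_def bin_weight_def add_divide_distrib power_divide power_mult_distrib mult_ac)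
    have r1: "mexp t (bin_weight t (1/2)) r = 1"
      using gen[of a b] gen[of b a] mexp_cmult[of t "bin_weight t (1/2)" "1/2" "\<lambda>j. a ^ j * b ^ (t - j) + b ^ j * a ^ (t - j)"]
      by (simp add: r_def[abs_def] mexp_add a_def b_def)
    define y where "y = 4 * s\<^sup>2 * real t"
    have y: "0 \<le> y" "y\<^sup>2 = 16 * \<kappa>\<^sup>2 / real n"
      using n t \<kappa> by (auto simp: y_def s2 power_divide power_mult_distrib)
    have "y \<le> 4 * \<kappa>"
    proof -
      have "y = 4 * \<kappa> / sqrt (real n)" using t by (simp add: y_def s2)
      also have "\<dots> \<le> 4 * \<kappa> / 1" using n \<kappa> by (intro divide_left_mono) auto
      finally show ?thesis by simp
    qed
    then have y1: "y \<le> 1" using \<kappa> by simp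
    have r2: "mexp t (bin_weight t (1/2)) (\<lambda>j. (r j)\<^sup>2) \<le> 1 + y\<^sup>2"
    proof -
      have "(\<lambda>j. (r j)\<^sup>2) = (\<lambda>j. (1/4) * ((a\<^sup>2) ^ j * (b\<^sup>2) ^ (t - j)) +
          ((1/4) * ((b\<^sup>2) ^ j * (a\<^sup>2) ^ (t - j)) + (1/2) * ((a * b) ^ j * (a * b) ^ (t - j))))"
        by (intro ext)
           (simp add: r_def power2_eq_square power_mult_distrib field_simps)
      then have "mexp t (bin_weight t (1/2)) (\<lambda>j. (r j)\<^sup>2) =
          (1/4) * ((a\<^sup>2 + b\<^sup>2) / 2) ^ t + ((1/4) * ((b\<^sup>2 + a\<^sup>2) / 2) ^ t + (1/2) * ((a * b + a * b) / 2) ^ t)"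
        by (simp only: mexp_add mexp_cmult gen)
      also have "\<dots> = ((1 + 4 * s\<^sup>2) ^ t + (1 + - (4 * s\<^sup>2)) ^ t) / 2"
      proof -
        have eqs: "(a\<^sup>2 + b\<^sup>2) / 2 = 1 + 4 * s\<^sup>2" "(b\<^sup>2 + a\<^sup>2) / 2 = 1 + 4 * s\<^sup>2"
          "(a * b + a * b) / 2 = 1 + - (4 * s\<^sup>2)"
          by (simp_all add: a_def b_def power2_eq_square field_simps)
        show ?thesis unfolding eqs by simp
      qed
      also have "\<dots> \<le> (exp y + exp (- y)) / 2"
      proof (intro divide_right_mono add_mono)
        have "(1 + 4 * s\<^sup>2) ^ t \<le> exp (4 * s\<^sup>2) ^ t"
          using exp_ge_add_one_self[of "4 * s\<^sup>2"] by (intro power_mono) auto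
        then show "(1 + 4 * s\<^sup>2) ^ t \<le> exp y" by (simp add: y_def exp_of_nat2_mult)
        have "s\<^sup>2 \<le> 1 / 4" using s abs_le_square_iff[of s "1/2"] by (simp add: power2_eq_square)
        then have "(1 + - (4 * s\<^sup>2)) ^ t \<le> exp (- (4 * s\<^sup>2)) ^ t"
          using exp_ge_add_one_self[of "- (4 * s\<^sup>2)"] by (intro power_mono) auto
        then show "(1 + - (4 * s\<^sup>2)) ^ t \<le> exp (- y)" by (simp add: y_def flip: exp_of_nat2_mult)
      qed simp
      also have "\<dots> \<le> 1 + y\<^sup>2" using y y1 by (intro average_exp_le)
      finally show ?thesis .
    qed
    define \<Lambda> where "\<Lambda> X = (\<Prod>i<n. r (X i))" for X :: "nat \<Rightarrow> nat"
    have \<Lambda>1: "?E \<Lambda> = 1"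
      using pexp_prod[of n t "\<lambda>_. bin_weight t (1/2)" "\<lambda>_. r"] by (simp add: \<Lambda>_def[abs_def] r1)
    have "?E (\<lambda>X. (\<Lambda> X)\<^sup>2) = mexp t (bin_weight t (1/2)) (\<lambda>j. (r j)\<^sup>2) ^ n"
      using pexp_prod[of n t "\<lambda>_. bin_weight t (1/2)" "\<lambda>_ j. (r j)\<^sup>2"]
      by (simp add: \<Lambda>_def prod_power_distrib)
    also have "\<dots> \<le> exp (y\<^sup>2) ^ n"
    proof (intro power_mono)
      show "mexp t (bin_weight t (1/2)) (\<lambda>j. (r j)\<^sup>2) \<le> exp (y\<^sup>2)"
        using r2 exp_ge_add_one_self[of "y\<^sup>2"] by linarith
    qed (auto simp: mexp_def bin_weight_nonneg intro!: sum_nonneg)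
    also have "\<dots> = exp (16 * \<kappa>\<^sup>2)" using n by (simp add: y flip: exp_of_nat_mult)
    also have "\<dots> \<le> 1 + 16 * \<kappa>\<^sup>2 + (16 * \<kappa>\<^sup>2)\<^sup>2"
    proof (intro exp_bound)
      have "\<kappa> * \<kappa> \<le> 1 / 12 * (1 / 12)" using \<kappa> by (intro mult_mono) auto
      then show "16 * \<kappa>\<^sup>2 \<le> 1" by (simp add: power2_eq_square)
    qed simp
    also have "\<dots> \<le> 1 + 32 * \<kappa>\<^sup>2"
    proof -
      have "\<kappa> * \<kappa> \<le> 1 / 12 * (1 / 12)" using \<kappa> by (intro mult_mono) auto
      then have "16 * \<kappa>\<^sup>2 * (16 * \<kappa>\<^sup>2) \<le> 16 * \<kappa>\<^sup>2 * 1"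
        by (intro mult_left_mono) (auto simp: power2_eq_square)
      then show ?thesis by (simp add: power2_eq_square[of "16 * \<kappa>\<^sup>2"])
    qed
    finally have \<Lambda>2: "?E (\<lambda>X. (\<Lambda> X)\<^sup>2) \<le> 1 + 32 * \<kappa>\<^sup>2" .
    have var: "?E (\<lambda>X. (\<Lambda> X - 1)\<^sup>2) \<le> 32 * \<kappa>\<^sup>2"
    proof -
      have "?E (\<lambda>X. (\<Lambda> X - 1)\<^sup>2) = ?E (\<lambda>X. (\<Lambda> X)\<^sup>2 + ((- 2) * \<Lambda> X + 1))"
        by (rule pexp_cong) (simp add: power2_eq_square algebra_simps)
      also have "\<dots> = ?E (\<lambda>X. (\<Lambda> X)\<^sup>2) - 1"
        by (simp only: pexp_add pexp_cmult \<Lambda>1 N.pexp_const)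
      finally show ?thesis using \<Lambda>2 by simp
    qed
    have "pexp n t (\<lambda>_. mix_weight t ?\<pi>) (\<lambda>X. of_bool (\<psi> X = 1)) = ?E (\<lambda>X. \<Lambda> X * of_bool (\<psi> X = 1))"
      unfolding pexp_def
    proof (intro sum.cong refl)
      fix X assume X: "X \<in> {..<n} \<rightarrow>\<^sub>E {..t}"
      have "(\<Prod>i<n. mix_weight t ?\<pi> (X i)) = (\<Prod>i<n. bin_weight t (1/2) (X i) * r (X i))"
        using X by (intro prod.cong refl mix) (auto simp: PiE_iff)
      then show "(\<Prod>i<n. mix_weight t ?\<pi> (X i)) * of_bool (\<psi> X = 1) =
          (\<Prod>i<n. bin_weight t (1/2) (X i)) * (\<Lambda> X * of_bool (\<psi> X = 1))"
        by (simp add: \<Lambda>_def prod.distrib)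
    qed
    \<comment> \<open>\<open>y \<le> y\<^sup>2 / (2 * l) + l / 2\<close> for \<open>y = \<Lambda> X - 1\<close> and \<open>l = 6 * \<kappa>\<close>\<close>
    also have "\<dots> \<le> ?E (\<lambda>X. of_bool (\<psi> X = 1) + (1 / (12 * \<kappa>) * (\<Lambda> X - 1)\<^sup>2 + 3 * \<kappa>))"
    proof (rule N.pexp_mono)
      fix X
      have "0 \<le> (\<Lambda> X - 1 - 6 * \<kappa>)\<^sup>2 / (12 * \<kappa>)" using \<kappa> by simp
      also have "\<dots> = 1 / (12 * \<kappa>) * (\<Lambda> X - 1)\<^sup>2 + 3 * \<kappa> - (\<Lambda> X - 1)"
        using \<kappa> by (simp add: field_simps power2_eq_square)
      finally have "\<Lambda> X - 1 \<le> 1 / (12 * \<kappa>) * (\<Lambda> X - 1)\<^sup>2 + 3 * \<kappa>" by simp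
      moreover have "0 \<le> 1 / (12 * \<kappa>) * (\<Lambda> X - 1)\<^sup>2 + 3 * \<kappa>" using \<kappa> by simp
      ultimately show "\<Lambda> X * of_bool (\<psi> X = 1) \<le>
          of_bool (\<psi> X = 1) + (1 / (12 * \<kappa>) * (\<Lambda> X - 1)\<^sup>2 + 3 * \<kappa>)"
        by (cases "\<psi> X = 1") (simp_all del: times_divide_eq_left)
    qed
    also have "\<dots> = ?E (\<lambda>X. of_bool (\<psi> X = 1)) + (1 / (12 * \<kappa>) * ?E (\<lambda>X. (\<Lambda> X - 1)\<^sup>2) + 3 * \<kappa>)"
      by (simp only: pexp_add pexp_cmult N.pexp_const)
    also have "\<dots> \<le> \<alpha> + (1 / (12 * \<kappa>) * (32 * \<kappa>\<^sup>2) + 3 * \<kappa>)"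
      using level_testsD[OF \<psi>, of "1/2"] var \<kappa> by (intro add_mono mult_left_mono) auto
    also have "\<dots> \<le> \<alpha> + 6 * \<kappa>" using \<kappa> by (simp add: power2_eq_square)
    finally show ?thesis using type_II_eq[OF \<pi> \<psi>] by simp
  qed
  ultimately show "\<exists>\<pi>\<in>mixing_dists. sqrt ((1 - \<alpha> - \<beta>) / 12 / (real t * sqrt (real n))) \<le> W1_set \<pi> point_masses \<and>
      1 - \<alpha> - 6 * \<kappa> \<le> pexp n t (\<lambda>_. mix_weight t \<pi>) (\<lambda>X. of_bool (\<psi> X = 0))"
    using \<pi> by (auto simp: s_def \<kappa>_def)
qed (use \<alpha> \<beta> in auto)

section \<open>Lower tail of the variance estimator under the alternative\<close>

text \<open>Pairing the first half of the sample with the second half bounds the sample variance below by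
  an average of absolute differences. An odd last observation is dropped.\<close>

lemma sample_var_ge_split:
  assumes n: "2 \<le> n" and m: "m = n div 2" and \<epsilon>: "0 \<le> \<epsilon>"
    and D: "real m * \<epsilon> / 4 \<le> (\<Sum>k<m. \<bar>p k - p (m + k)\<bar>)"
  shows "\<epsilon>\<^sup>2 / 64 \<le> sample_var n p"
proof -
  define q where "q = sample_mean n p"
  have m0: "1 \<le> m" and m2: "m + m \<le> n" "real n - 1 \<le> 2 * real m" using n m by linarith+
  define I where "I = (\<lambda>k. m + k) ` {..<m}"
  have "(real m * \<epsilon> / 4)\<^sup>2 \<le> (\<Sum>k<m. \<bar>p k - p (m + k)\<bar>)\<^sup>2"
    using D \<epsilon> by (intro power_mono) auto
  also have "\<dots> \<le> (\<Sum>k<m. \<bar>p k - p (m + k)\<bar>\<^sup>2) * real m"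
    using sum_squared_le_sum_of_squares[of "\<lambda>k. \<bar>p k - p (m + k)\<bar>" "{..<m}"] by simp
  also have "(\<Sum>k<m. \<bar>p k - p (m + k)\<bar>\<^sup>2) \<le> (\<Sum>k<m. 2 * ((p k - q)\<^sup>2 + (p (m + k) - q)\<^sup>2))"
    using sum_two_square_le[of "p _ - q" "p (m + _) - q"] by (intro sum_mono) simp
  also have "\<dots> = 2 * ((\<Sum>k<m. (p k - q)\<^sup>2) + (\<Sum>k<m. (p (m + k) - q)\<^sup>2))"
    by (simp add: sum.distrib distrib_left sum_distrib_left)
  also have "(\<Sum>k<m. (p (m + k) - q)\<^sup>2) = (\<Sum>i\<in>I. (p i - q)\<^sup>2)"
    unfolding I_def by (subst sum.reindex) auto
  also have "(\<Sum>k<m. (p k - q)\<^sup>2) + (\<Sum>i\<in>I. (p i - q)\<^sup>2) = (\<Sum>i\<in>{..<m} \<union> I. (p i - q)\<^sup>2)"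
    by (subst sum.union_disjoint) (auto simp: I_def)
  also have "\<dots> \<le> (\<Sum>i<n. (p i - q)\<^sup>2)"
    using m2 by (intro sum_mono2) (auto simp: I_def)
  finally have "(real m * \<epsilon> / 4)\<^sup>2 \<le> 2 * (\<Sum>i<n. (p i - q)\<^sup>2) * real m"
    by (simp add: mult_right_mono)
  then have "real m * (real m * \<epsilon>\<^sup>2) \<le> real m * (32 * (\<Sum>i<n. (p i - q)\<^sup>2))"
    by (simp add: power2_eq_square field_simps)
  then have *: "real m * \<epsilon>\<^sup>2 \<le> 32 * (\<Sum>i<n. (p i - q)\<^sup>2)"
    using m0 by (subst (asm) mult_le_cancel_left_pos) auto
  have "\<epsilon>\<^sup>2 * (real n - 1) \<le> \<epsilon>\<^sup>2 * (2 * real m)" using m2 by (intro mult_left_mono) auto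
  then have "\<epsilon>\<^sup>2 * (real n - 1) \<le> 64 * (\<Sum>i<n. (p i - q)\<^sup>2)"
    using * by (simp only: mult.left_commute mult.commute)
  then show ?thesis using n by (simp add: sample_var_def q_def field_simps)
qed

lemma exp_minus_le: "0 \<le> d \<Longrightarrow> d \<le> 1 \<Longrightarrow> exp (- d) \<le> 1 - d / 2" for d :: real
proof -
  assume d: "0 \<le> d" "d \<le> 1"
  have "exp (- d) = 1 / exp d" by (simp add: exp_minus inverse_eq_divide)
  also have "\<dots> \<le> 1 / (1 + d)" using d exp_ge_add_one_self[of d] by (intro divide_left_mono) auto
  also have "\<dots> \<le> 1 - d / 2"
  proof -
    have "d * d \<le> d * 1" using d by (intro mult_left_mono) auto
    then have "1 \<le> (1 - d / 2) * (1 + d)" by (simp add: field_simps)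
    then show ?thesis using d by (simp add: divide_le_eq)
  qed
  finally show ?thesis .
qed

lemma laplace_abs_deviation:
  assumes \<pi>: "\<pi> \<in> mixing_dists" and s: "s \<in> {0..1}" and \<epsilon>: "\<epsilon> \<le> (LINT p|\<pi>. \<bar>p - s\<bar>)"
  shows "(LINT p|\<pi>. exp (- \<bar>clip p - s\<bar>)) \<le> exp (- (\<epsilon> / 2))"
proof -
  interpret prob_space \<pi> using mixing_distsD[OF \<pi>] by simp
  have int: "integrable \<pi> (\<lambda>p. \<bar>p - s\<bar>)"
    using s by (intro integrable_bounded_mixing[OF \<pi>, where B=1]) auto
  have "(LINT p|\<pi>. exp (- \<bar>clip p - s\<bar>)) \<le> (LINT p|\<pi>. 1 - \<bar>p - s\<bar> / 2)"
  proof (rule integral_mono_AE)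
    show "integrable \<pi> (\<lambda>p. exp (- \<bar>clip p - s\<bar>))"
      by (intro integrable_bounded_mixing[OF \<pi>, where B=1]) auto
    show "integrable \<pi> (\<lambda>p. 1 - \<bar>p - s\<bar> / 2)" using int by simp
    show "AE p in \<pi>. exp (- \<bar>clip p - s\<bar>) \<le> 1 - \<bar>p - s\<bar> / 2"
      using mixing_distsD(3)[OF \<pi>]
    proof eventually_elim
      case (elim p)
      then show ?case using s exp_minus_le[of "\<bar>p - s\<bar>"] by (auto simp: clip_id)
    qed
  qed
  also have "\<dots> = 1 - (LINT p|\<pi>. \<bar>p - s\<bar>) / 2" using int by (simp add: prob_space)
  also have "\<dots> \<le> 1 + (- (\<epsilon> / 2))" using \<epsilon> by simp
  also have "\<dots> \<le> exp (- (\<epsilon> / 2))" by (rule exp_ge_add_one_self)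
  finally show ?thesis .
qed

text \<open>Given the second half of the sample, the absolute differences are independent and each has
  mean at least \<open>\<epsilon>\<close>, whatever the values in the second half are; since
  the differences are at most 1, the first absolute moment alone controls the Laplace
  transform.\<close>

lemma laplace_split_sample:
  assumes \<pi>: "\<pi> \<in> mixing_dists" and m: "m + m \<le> n"
    and \<epsilon>: "\<And>s. s \<in> {0..1} \<Longrightarrow> \<epsilon> \<le> (LINT p|\<pi>. \<bar>p - s\<bar>)"
  defines "F \<equiv> \<lambda>p. exp (- (\<Sum>k<m. \<bar>clip (p k) - clip (p (m + k))\<bar>))"
  shows "integrable (PiM {..<n} (\<lambda>_. \<pi>)) F"
    and "(LINT p|PiM {..<n} (\<lambda>_. \<pi>). F p) \<le> exp (- (real m * \<epsilon> / 2))"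
proof -
  interpret mix: prob_space \<pi> using mixing_distsD[OF \<pi>] by simp
  interpret product_prob_space "\<lambda>_::nat. \<pi>" by standard
  note [measurable_cong] = mixing_distsD(2)[OF \<pi>]
  define J where "J = {m..<n}"
  have un: "J \<union> {..<m} = {..<n}" "J \<inter> {..<m} = {}" using m by (auto simp: J_def)
  interpret all: prob_space "PiM {..<n} (\<lambda>_. \<pi>)" by (intro prob_space_PiM mix.prob_space_axioms)
  interpret J: prob_space "PiM J (\<lambda>_. \<pi>)" by (intro prob_space_PiM mix.prob_space_axioms)
  have Fmeas: "F \<in> borel_measurable (PiM {..<n} (\<lambda>_. \<pi>))"
  proof -
    have clip: "(\<lambda>p. clip (p i)) \<in> borel_measurable (PiM {..<n} (\<lambda>_. \<pi>))" if "i < n" for i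
    proof (rule measurable_compose[OF _ measurable_clip])
      have "(\<lambda>p. p i) \<in> measurable (PiM {..<n} (\<lambda>_. \<pi>)) \<pi>"
        using that by (intro measurable_component_singleton) auto
      then show "(\<lambda>p. p i) \<in> borel_measurable (PiM {..<n} (\<lambda>_. \<pi>))"
        using mixing_distsD(2)[OF \<pi>] by (simp cong: measurable_cong_sets)
    qed
    have dist: "(\<lambda>p. \<bar>clip (p k) - clip (p (m + k))\<bar>) \<in> borel_measurable (PiM {..<n} (\<lambda>_. \<pi>))"
      if "k < m" for k
      using that m by (intro borel_measurable_abs borel_measurable_diff clip) auto
    have "(\<lambda>p. - (\<Sum>k<m. \<bar>clip (p k) - clip (p (m + k))\<bar>)) \<in> borel_measurable (PiM {..<n} (\<lambda>_. \<pi>))"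
      by (intro borel_measurable_uminus borel_measurable_sum dist) simp
    from measurable_compose[OF this borel_measurable_exp] show ?thesis unfolding F_def .
  qed
  show int: "integrable (PiM {..<n} (\<lambda>_. \<pi>)) F"
    by (rule all.integrable_const_bound[where B=1]) (use Fmeas in \<open>auto simp: F_def intro!: sum_nonneg\<close>)
  have inner: "(LINT y|PiM {..<m} (\<lambda>_. \<pi>). F (merge J {..<m} (x, y))) \<le> exp (- (real m * \<epsilon> / 2))" for x
  proof -
    have F: "F (merge J {..<m} (x, y)) = (\<Prod>k<m. exp (- \<bar>clip (y k) - clip (x (m + k))\<bar>))" for y
      using m unfolding F_def
      by (simp add: merge_def J_def exp_sum flip: sum_negf)
    have "(LINT y|PiM {..<m} (\<lambda>_. \<pi>). F (merge J {..<m} (x, y))) =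
        (\<Prod>k<m. (LINT q|\<pi>. exp (- \<bar>clip q - clip (x (m + k))\<bar>)))"
      unfolding F
      by (rule product_integral_prod) (auto intro!: integrable_bounded_mixing[OF \<pi>, where B=1])
    also have "\<dots> \<le> (\<Prod>k<m. exp (- (\<epsilon> / 2)))"
      by (intro prod_mono conjI laplace_abs_deviation \<pi> \<epsilon>) (auto intro!: integral_nonneg)
    also have "\<dots> = exp (- (real m * \<epsilon> / 2))" by (simp flip: exp_of_nat_mult)
    finally show ?thesis .
  qed
  have "(LINT p|PiM {..<n} (\<lambda>_. \<pi>). F p) =
      (LINT x|PiM J (\<lambda>_. \<pi>). (LINT y|PiM {..<m} (\<lambda>_. \<pi>). F (merge J {..<m} (x, y))))"
    unfolding un(1)[symmetric] using un int by (intro product_integral_fold) (auto simp: J_def)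
  also have "\<dots> \<le> (LINT x|PiM J (\<lambda>_. \<pi>). exp (- (real m * \<epsilon> / 2)))"
    using inner by (intro integral_mono') auto
  also have "\<dots> = exp (- (real m * \<epsilon> / 2))" by (simp add: J.prob_space)
  finally show "(LINT p|PiM {..<n} (\<lambda>_. \<pi>). F p) \<le> exp (- (real m * \<epsilon> / 2))" .
qed

text \<open>Chebyshev around the mean \<open>sample_var n p\<close>, which is at least twice the level
  in question.\<close>

lemma V_hat_lower_tail_given_p:
  assumes n: "2 \<le> n" and t: "2 \<le> t" and p: "\<And>i. i < n \<Longrightarrow> 0 \<le> p i \<and> p i \<le> 1"
    and L: "1 \<le> L" "2 * K \<le> L" and S: "L / (real t * sqrt (real n)) \<le> sample_var n p"
  shows "pexp n t (\<lambda>i. bin_weight t (p i)) (\<lambda>X. of_bool (V_hat n t X \<le> K / (real t * sqrt (real n)))) \<le> 29 / L"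
proof -
  interpret product_weights n t "\<lambda>i. bin_weight t (p i)"
    using p by (rule product_weights_binomial)
  define S where "S = sample_var n p"
  define \<tau> where "\<tau> = real t * sqrt (real n)"
  have \<tau>: "0 < \<tau>" "\<tau>\<^sup>2 = real n * (real t)\<^sup>2" using n t by (auto simp: \<tau>_def power_mult_distrib)
  have LS: "L \<le> S * \<tau>" using S \<tau> by (simp add: S_def \<tau>_def field_simps)
  have S0: "0 < S" using LS L \<tau> by (smt (verit) zero_less_mult_pos2)
  have "pexp n t (\<lambda>i. bin_weight t (p i)) (\<lambda>X. of_bool (V_hat n t X \<le> K / \<tau>)) \<le>
      pexp n t (\<lambda>i. bin_weight t (p i)) (\<lambda>X. (V_hat n t X - S)\<^sup>2) / (S / 2)\<^sup>2"
  proof (rule chebyshev)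
    fix X assume V: "V_hat n t X \<le> K / \<tau>"
    have "K / \<tau> \<le> S / 2" using LS L \<tau> by (simp add: field_simps)
    then show "S / 2 \<le> \<bar>V_hat n t X - S\<bar>" using V by linarith
  qed (use S0 in auto)
  also have "\<dots> \<le> (24 * (1/4) * S / (real n * real t) + 18 * (1/4)\<^sup>2 / (real n * (real t)\<^sup>2)) / (S / 2)\<^sup>2"
    unfolding S_def
  proof (intro divide_right_mono V_hat_second_moment n t)
    fix i assume "i < n"
    show "p i * (1 - p i) \<le> 1 / 4"
      using zero_le_power2[of "p i - 1/2"] by (simp add: power2_eq_square algebra_simps)
  qed (use p in auto)
  also have "\<dots> = 24 / (real n * real t * S) + (9 / 2) / (\<tau> * S)\<^sup>2"
    using S0 \<tau> n t by (simp add: power_mult_distrib power2_eq_square field_simps)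
  also have "\<dots> \<le> 24 / L + (9 / 2) / L"
  proof (intro add_mono divide_left_mono)
    have "sqrt (real n) \<le> real n"
      using n by (intro real_le_lsqrt) (auto simp: power2_eq_square)
    then have "real t * sqrt (real n) \<le> real t * real n" by (intro mult_left_mono) auto
    then have "\<tau> * S \<le> real n * real t * S"
      using S0 by (intro mult_right_mono) (auto simp: \<tau>_def mult.commute)
    then show "L \<le> real n * real t * S" using LS by (simp add: mult_ac)
    have "L * 1 \<le> (\<tau> * S) * (\<tau> * S)" using LS L by (intro mult_mono) (auto simp: mult_ac)
    then show "L \<le> (\<tau> * S)\<^sup>2" by (simp add: power2_eq_square)
  qed (use L S0 \<tau> n t in auto)
  also have "\<dots> \<le> 29 / L" using L by (simp add: field_simps)
  finally show ?thesis by (simp add: \<tau>_def)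
qed

text \<open>The lower tail has two causes: an untypical draw of the success probabilities, with
  exponentially small probability, or, given a typical draw, large binomial noise.\<close>

lemma V_hat_lower_tail:
  assumes n: "2 \<le> n" and t: "2 \<le> t" and \<pi>: "\<pi> \<in> mixing_dists"
    and L: "1 \<le> L" "2 * K \<le> L"
    and \<epsilon>: "0 \<le> \<epsilon>" "\<epsilon> \<le> W1_set \<pi> point_masses" "L / (real t * sqrt (real n)) \<le> \<epsilon>\<^sup>2 / 64"
  shows "pexp n t (\<lambda>_. mix_weight t \<pi>) (\<lambda>X. of_bool (V_hat n t X \<le> K / (real t * sqrt (real n))))
    \<le> 29 / L + exp (- (real (n div 2) * \<epsilon> / 4))"
proof -
  interpret mix: prob_space \<pi> using mixing_distsD[OF \<pi>] by simp
  interpret all: prob_space "PiM {..<n} (\<lambda>_. \<pi>)" by (intro prob_space_PiM mix.prob_space_axioms)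
  define m where "m = n div 2"
  have m: "m + m \<le> n" by (simp add: m_def)
  define F where "F p = exp (- (\<Sum>k<m. \<bar>clip (p k) - clip (p (m + k))\<bar>))" for p :: "nat \<Rightarrow> real"
  define P where "P X \<longleftrightarrow> V_hat n t X \<le> K / (real t * sqrt (real n))" for X
  have dev: "\<epsilon> \<le> (LINT p|\<pi>. \<bar>p - s\<bar>)" if "s \<in> {0..1}" for s
    using W1_set_point_masses_le[OF \<pi> that] \<epsilon> by simp
  note F = laplace_split_sample[OF \<pi> m dev, folded F_def]
  have F_int: "integrable (PiM {..<n} (\<lambda>_. \<pi>)) F"
    and F_le: "(LINT p|PiM {..<n} (\<lambda>_. \<pi>). F p) \<le> exp (- (real m * \<epsilon> / 2))"
    using F by (simp_all add: F_def[abs_def])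
  have "pexp n t (\<lambda>_. mix_weight t \<pi>) (\<lambda>X. of_bool (P X)) =
      (LINT p|PiM {..<n} (\<lambda>_. \<pi>). pexp n t (\<lambda>i. bin_weight t (clip (p i))) (\<lambda>X. of_bool (P X)))"
    by (rule mixture_of_products(1)[OF \<pi>])
  also have "\<dots> \<le> (LINT p|PiM {..<n} (\<lambda>_. \<pi>). 29 / L + exp (real m * \<epsilon> / 4) * F p)"
  proof (rule integral_mono)
    show "integrable (PiM {..<n} (\<lambda>_. \<pi>)) (\<lambda>p. 29 / L + exp (real m * \<epsilon> / 4) * F p)"
      using F_int by simp
    fix p :: "nat \<Rightarrow> real"
    interpret product_weights n t "\<lambda>i. bin_weight t (clip (p i))"
      by (rule product_weights_binomial) auto
    show "pexp n t (\<lambda>i. bin_weight t (clip (p i))) (\<lambda>X. of_bool (P X)) \<le> 29 / L + exp (real m * \<epsilon> / 4) * F p"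
    proof (cases "real m * \<epsilon> / 4 \<le> (\<Sum>k<m. \<bar>clip (p k) - clip (p (m + k))\<bar>)")
      case True
      have "L / (real t * sqrt (real n)) \<le> sample_var n (\<lambda>i. clip (p i))"
        by (rule order.trans[OF \<epsilon>(3) sample_var_ge_split[OF n m_def \<epsilon>(1) True]])
      then have "pexp n t (\<lambda>i. bin_weight t (clip (p i))) (\<lambda>X. of_bool (P X)) \<le> 29 / L"
        unfolding P_def by (intro V_hat_lower_tail_given_p n t L) auto
      also have "\<dots> \<le> 29 / L + exp (real m * \<epsilon> / 4) * F p" by (simp add: F_def)
      finally show ?thesis .
    next
      case False
      have "pexp n t (\<lambda>i. bin_weight t (clip (p i))) (\<lambda>X. of_bool (P X)) \<le>
          pexp n t (\<lambda>i. bin_weight t (clip (p i))) (\<lambda>X. 1)"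
        by (rule pexp_mono) simp
      also have "\<dots> = 1" by (rule pexp_const)
      also have "1 \<le> exp (real m * \<epsilon> / 4) * F p"
        using False by (simp add: F_def flip: exp_add)
      finally show ?thesis using L by (simp add: add_increasing)
    qed
  qed (rule mixture_of_products(2)[OF \<pi>])
  also have "\<dots> = 29 / L + exp (real m * \<epsilon> / 4) * (LINT p|PiM {..<n} (\<lambda>_. \<pi>). F p)"
    using F_int by (simp add: all.prob_space)
  also have "\<dots> \<le> 29 / L + exp (real m * \<epsilon> / 4) * exp (- (real m * \<epsilon> / 2))"
    using F_le by (intro add_left_mono mult_left_mono) auto
  also have "\<dots> = 29 / L + exp (- (real m * \<epsilon> / 4))"
    by (simp flip: exp_add)
  finally show ?thesis by (simp add: P_def m_def)
qed

section \<open>The test and its threshold\<close>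

lemma space_two_samples:
  "space (two_samples n (binomial_mixture t \<pi>)) = ({..<n} \<rightarrow>\<^sub>E {..t}) \<times> ({..<n} \<rightarrow>\<^sub>E {..t})"
  by (simp add: two_samples_def space_pair_measure space_sample)

lemma finite_nonempty_two_samples:
  "finite (space (two_samples n (binomial_mixture t \<pi>)))" "space (two_samples n (binomial_mixture t \<pi>)) \<noteq> {}"
  by (auto simp: space_two_samples PiE_eq_empty_iff)

lemma prob_space_two_samples:
  assumes "\<pi> \<in> mixing_dists"
  shows "prob_space (two_samples n (binomial_mixture t \<pi>))"
proof -
  interpret prob_space "sample n (binomial_mixture t \<pi>)" by (rule prob_space_sample) fact
  interpret pair_prob_space "sample n (binomial_mixture t \<pi>)" "sample n (binomial_mixture t \<pi>)" by standard
  show ?thesis unfolding two_samples_def by (rule P.prob_space_axioms)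
qed

lemma two_samples_union_bound:
  assumes \<pi>: "\<pi> \<in> mixing_dists"
    and P: "\<And>X Y. X \<in> {..<n} \<rightarrow>\<^sub>E {..t} \<Longrightarrow> Y \<in> {..<n} \<rightarrow>\<^sub>E {..t} \<Longrightarrow> P (X, Y) \<Longrightarrow> A X \<or> B Y"
  shows "measure (two_samples n (binomial_mixture t \<pi>)) {z \<in> space (two_samples n (binomial_mixture t \<pi>)). P z}
    \<le> pexp n t (\<lambda>_. mix_weight t \<pi>) (\<lambda>X. of_bool (A X)) + pexp n t (\<lambda>_. mix_weight t \<pi>) (\<lambda>Y. of_bool (B Y))"
proof -
  let ?M = "sample n (binomial_mixture t \<pi>)" and ?S = "{..<n} \<rightarrow>\<^sub>E {..t}"
  interpret M: prob_space ?M by (rule prob_space_sample) fact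
  interpret MM: prob_space "two_samples n (binomial_mixture t \<pi>)" by (rule prob_space_two_samples) fact
  have in_sets: "{X \<in> ?S. Q X} \<in> sets ?M" "?S \<in> sets ?M" for Q by (auto simp: sets_sample[OF \<pi>])
  let ?A = "{X \<in> ?S. A X} \<times> ?S" and ?B = "?S \<times> {Y \<in> ?S. B Y}"
  have AB: "?A \<in> MM.events" "?B \<in> MM.events"
    unfolding two_samples_def using in_sets by (auto intro!: pair_measureI)
  have one: "emeasure ?M ?S = 1" using M.emeasure_space_1 by (simp add: space_sample)
  have mA: "MM.prob ?A = pexp n t (\<lambda>_. mix_weight t \<pi>) (\<lambda>X. of_bool (A X))"
    unfolding measure_sample[OF \<pi>, symmetric]
    unfolding measure_def two_samples_def using in_sets one by (subst M.emeasure_pair_measure_Times) auto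
  have mB: "MM.prob ?B = pexp n t (\<lambda>_. mix_weight t \<pi>) (\<lambda>X. of_bool (B X))"
    unfolding measure_sample[OF \<pi>, symmetric]
    unfolding measure_def two_samples_def using in_sets one by (subst M.emeasure_pair_measure_Times) auto
  have "MM.prob {z \<in> space (two_samples n (binomial_mixture t \<pi>)). P z} \<le> MM.prob (?A \<union> ?B)"
    using AB P by (intro MM.finite_measure_mono) (auto simp: space_two_samples)
  also have "\<dots> \<le> MM.prob ?A + MM.prob ?B"
    using AB by (rule measure_Un_le)
  finally show ?thesis by (simp only: mA mB)
qed

text \<open>On a finite sample space the infimum that defines the upper quantile is attained, since
  \<open>{z. R z > u}\<close> does not change while \<open>u\<close> increases slightly
  above that infimum.\<close>

lemma
  fixes R :: "(nat \<Rightarrow> nat) \<times> (nat \<Rightarrow> nat) \<Rightarrow> real" and n t :: nat and \<pi> :: "real measure"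
  assumes \<pi>: "\<pi> \<in> mixing_dists" and \<alpha>: "0 \<le> \<alpha>" "\<alpha> < 1"
  defines "M \<equiv> two_samples n (binomial_mixture t \<pi>)"
  shows upper_quantile_le: "measure M {z \<in> space M. R z > u} \<le> \<alpha> \<Longrightarrow>
      upper_quantile \<alpha> n (binomial_mixture t \<pi>) R \<le> u"
    and upper_quantile_attained:
      "measure M {z \<in> space M. R z > upper_quantile \<alpha> n (binomial_mixture t \<pi>) R} \<le> \<alpha>"
    and upper_quantile_le_Max:
      "upper_quantile \<alpha> n (binomial_mixture t \<pi>) R \<le> Max (R ` space M)"
proof -
  interpret prob_space M unfolding M_def by (rule prob_space_two_samples) fact
  have fin: "finite (R ` space M)" "R ` space M \<noteq> {}"
    using finite_nonempty_two_samples by (auto simp: M_def)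
  define U where "U = {u. measure M {z \<in> space M. R z > u} \<le> \<alpha>}"
  define q where "q = Inf U"
  have q: "upper_quantile \<alpha> n (binomial_mixture t \<pi>) R = q"
    by (simp add: upper_quantile_def q_def U_def M_def)
  have bdd: "bdd_below U"
  proof (rule bdd_belowI)
    fix u assume u: "u \<in> U"
    show "Min (R ` space M) \<le> u"
    proof (rule ccontr)
      assume "\<not> Min (R ` space M) \<le> u"
      then have "u < Min (R ` space M)" by simp
      then have "\<forall>r\<in>R ` space M. u < r" using Min_gr_iff[OF fin] by blast
      then have "{z \<in> space M. R z > u} = space M" by blast
      then show False using u \<alpha> by (simp add: U_def prob_space)
    qed
  qed
  have le: "q \<le> u" if "u \<in> U" for u unfolding q_def by (rule cInf_lower[OF that bdd])
  then show "measure M {z \<in> space M. R z > u} \<le> \<alpha> \<Longrightarrow>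
      upper_quantile \<alpha> n (binomial_mixture t \<pi>) R \<le> u"
    by (simp add: q U_def)
  have "R z \<le> Max (R ` space M)" if "z \<in> space M" for z using fin that by (intro Max_ge) auto
  then have above_Max: "{z \<in> space M. R z > Max (R ` space M)} = {}" by fastforce
  then have Max: "Max (R ` space M) \<in> U" unfolding U_def mem_Collect_eq above_Max using \<alpha> by simp
  then show "upper_quantile \<alpha> n (binomial_mixture t \<pi>) R \<le> Max (R ` space M)"
    using le by (simp add: q)
  have "\<exists>u\<in>U. {z \<in> space M. R z > q} = {z \<in> space M. R z > u}"
  proof (cases "\<exists>z\<in>space M. R z > q")
    case True
    define w where "w = Min {r \<in> R ` space M. r > q}"
    have w: "w \<in> {r \<in> R ` space M. r > q}"
      unfolding w_def using True fin by (intro Min_in) auto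
    have wle: "w \<le> R z" if "z \<in> space M" "R z > q" for z
      unfolding w_def using that fin by (intro Min_le) auto
    obtain u where u: "u \<in> U" "u < w"
      using cInf_lessD[of U w] Max w unfolding q_def by auto
    have "R z > q \<longleftrightarrow> R z > u" if "z \<in> space M" for z
      using le[OF u(1)] u(2) wle[OF that] by linarith
    then show ?thesis using u(1) by blast
  next
    case False
    then have "{z \<in> space M. R z > q} = {z \<in> space M. R z > Max (R ` space M)}"
      using above_Max by blast
    then show ?thesis using Max by blast
  qed
  then obtain u where "u \<in> U" "{z \<in> space M. R z > q} = {z \<in> space M. R z > u}" by blast
  then show "measure M {z \<in> space M. R z > upper_quantile \<alpha> n (binomial_mixture t \<pi>) R} \<le> \<alpha>"
    unfolding q by (simp only: U_def mem_Collect_eq)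
qed

lemma upper_quantile_le_sup:
  assumes \<alpha>: "0 \<le> \<alpha>" "\<alpha> < 1" and \<pi>: "\<pi> \<in> point_masses"
  shows "upper_quantile \<alpha> n (binomial_mixture t \<pi>) R \<le>
    (SUP \<pi>\<in>point_masses. upper_quantile \<alpha> n (binomial_mixture t \<pi>) R)"
proof (rule cSUP_upper[OF \<pi>])
  show "bdd_above ((\<lambda>\<pi>. upper_quantile \<alpha> n (binomial_mixture t \<pi>) R) ` point_masses)"
  proof (rule bdd_aboveI2)
    fix \<rho> assume "\<rho> \<in> point_masses"
    then have "\<rho> \<in> mixing_dists" using point_masses_subset by blast
    from upper_quantile_le_Max[OF this \<alpha>, of n t R] show "upper_quantile \<alpha> n (binomial_mixture t \<rho>) R \<le>
        Max (R ` (({..<n} \<rightarrow>\<^sub>E {..t}) \<times> ({..<n} \<rightarrow>\<^sub>E {..t})))"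
      unfolding space_two_samples .
  qed
qed

lemma cochran_test_level:
  assumes \<alpha>: "0 \<le> \<alpha>" "\<alpha> < 1" and \<pi>: "\<pi> \<in> point_masses"
  shows "measure (two_samples n (binomial_mixture t \<pi>))
    {z \<in> space (two_samples n (binomial_mixture t \<pi>)). cochran_test \<alpha> n t \<gamma> z = 1} \<le> \<alpha>"
proof -
  let ?M = "two_samples n (binomial_mixture t \<pi>)" and ?R = "R_stat n t \<gamma>"
  let ?q = "upper_quantile \<alpha> n (binomial_mixture t \<pi>) ?R"
  have \<pi>': "\<pi> \<in> mixing_dists" using \<pi> point_masses_subset by auto
  interpret prob_space ?M by (rule prob_space_two_samples) fact
  have single: "{z} \<in> events" if "z \<in> space ?M" for z
  proof -
    have z: "fst z \<in> {..<n} \<rightarrow>\<^sub>E {..t}" "snd z \<in> {..<n} \<rightarrow>\<^sub>E {..t}"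
      using that unfolding space_two_samples mem_Times_iff by blast+
    have "{fst z} \<times> {snd z} \<in> events"
      unfolding two_samples_def using z sets_sample_singleton[OF \<pi>'] by (intro pair_measureI) blast+
    moreover have "{fst z} \<times> {snd z} = {z}" by simp
    ultimately show ?thesis by (simp only:)
  qed
  have sets: "A \<in> events" if A: "A \<subseteq> space ?M" for A
  proof -
    have "(\<Union>z\<in>A. {z}) \<in> events"
    proof (rule sets.finite_UN)
      show "finite A" by (rule finite_subset[OF A finite_nonempty_two_samples(1)])
      show "{z} \<in> events" if "z \<in> A" for z using single A that by blast
    qed
    then show ?thesis by (simp only: UN_singleton)
  qed
  define thr where "thr = (SUP \<pi>\<in>point_masses. upper_quantile \<alpha> n (binomial_mixture t \<pi>) ?R)"
  have "?q \<le> thr" unfolding thr_def by (rule upper_quantile_le_sup[OF \<alpha> \<pi>])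
  have "?R z > ?q" if one: "cochran_test \<alpha> n t \<gamma> z = 1" for z
  proof -
    have "cochran_test \<alpha> n t \<gamma> z = (if thr < ?R z then 1 else 0)"
      by (simp only: cochran_test_def thr_def)
    with one have "thr < ?R z" by (cases "thr < ?R z") simp_all
    with \<open>?q \<le> thr\<close> show ?thesis by (rule le_less_trans)
  qed
  then have "{z \<in> space ?M. cochran_test \<alpha> n t \<gamma> z = 1} \<subseteq> {z \<in> space ?M. ?R z > ?q}" by blast
  then have "prob {z \<in> space ?M. cochran_test \<alpha> n t \<gamma> z = 1} \<le> prob {z \<in> space ?M. ?R z > ?q}"
    by (rule finite_measure_mono) (rule sets, blast)
  also have "\<dots> \<le> \<alpha>" by (rule upper_quantile_attained[OF \<pi>' \<alpha>])
  finally show ?thesis .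
qed

text \<open>Let \<open>v = p * (1 - p)\<close> at the null distribution. With high probability the
  numerator is at most of order \<open>v / (t * sqrt n)\<close> when \<open>v\<close> is
  at least of order \<open>1 / n\<close>, and of order
  \<open>1 / (n * t * sqrt n)\<close> otherwise; the denominator is at least
  \<open>v / 2\<close> in the first case, and the truncation bounds it below in the second.
  The factor \<open>max 1 \<gamma>\<close> makes the bound sharp enough for arbitrarily
  large \<open>\<gamma>\<close>.\<close>

lemma null_R_stat_tail:
  assumes \<alpha>: "0 < \<alpha>" "\<alpha> < 1" and c: "0 < c" and n: "2 \<le> n" and t: "2 \<le> t"
    and \<gamma>: "c / real n \<le> \<gamma>" and \<pi>: "\<pi> \<in> point_masses"
  defines "K \<equiv> 36 / \<alpha> * (2 + 32 / \<alpha> / c + 32 / \<alpha>)"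
  shows "measure (two_samples n (binomial_mixture t \<pi>)) {z \<in> space (two_samples n (binomial_mixture t \<pi>)).
      R_stat n t \<gamma> z > K / (real t * sqrt (real n) * max 1 \<gamma>)} \<le> \<alpha>"
proof -
  obtain p where p: "0 \<le> p" "p \<le> 1" "\<pi> = return borel p"
    using \<pi> by (auto simp: point_masses_def)
  have \<pi>': "\<pi> \<in> mixing_dists" using \<pi> point_masses_subset by auto
  have mw: "mix_weight t \<pi> = bin_weight t p" using p by (simp add: mix_weight_return)
  interpret product_weights n t "\<lambda>_. bin_weight t p"
    using p by (intro product_weights_binomial) auto
  let ?E = "pexp n t (\<lambda>_. bin_weight t p)"
  define v where "v = p * (1 - p)"
  have v: "0 \<le> v" "v \<le> 1" using p by (auto simp: v_def intro: mult_le_one)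
  \<comment> \<open>\<open>K1\<close> and \<open>C1\<close> make each of the two exceptional probabilities at most \<open>\<alpha> / 2\<close>\<close>
  define K1 where "K1 = 36 / \<alpha>"
  define C1 where "C1 = 32 / \<alpha>"
  have K1: "36 \<le> K1" and C1: "32 \<le> C1" using \<alpha> by (auto simp: K1_def C1_def field_simps)
  have K: "K = K1 * (2 + C1 / c + C1)" by (simp only: K_def K1_def C1_def)
  \<comment> \<open>below \<open>C1 / n\<close> the exact size of \<open>v\<close> is irrelevant; \<open>v'\<close> is positive even for \<open>v = 0\<close>\<close>
  define v' where "v' = max v (C1 / real n)"
  have v': "0 < v'" "v \<le> v'" using C1 n by (auto simp: v'_def less_max_iff_disj)
  define \<tau> where "\<tau> = real t * sqrt (real n)"
  have \<tau>: "0 < \<tau>" "\<tau>\<^sup>2 = real n * (real t)\<^sup>2" using n t by (auto simp: \<tau>_def power_mult_distrib)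
  have \<gamma>0: "0 < \<gamma>" using \<gamma> c n less_le_trans[of 0 "c / real n" \<gamma>] by simp
  define A where "A X \<longleftrightarrow> K1 * v' / \<tau> \<le> V_hat n t X" for X
  define B where "B Y \<longleftrightarrow> C1 \<le> real n * v \<and> mu_hat n t Y \<le> v / 2" for Y
  have "?E (\<lambda>X. of_bool (A X)) \<le> ?E (\<lambda>X. (V_hat n t X)\<^sup>2) / (K1 * v' / \<tau>)\<^sup>2"
    using K1 v' \<tau> by (intro chebyshev) (auto simp: A_def)
  also have "\<dots> \<le> (18 * v'\<^sup>2 / \<tau>\<^sup>2) / (K1 * v' / \<tau>)\<^sup>2"
  proof (rule divide_right_mono)
    have "sample_var n (\<lambda>_. p) = 0" using n by (simp add: sample_var_def sample_mean_def)
    then have "?E (\<lambda>X. (V_hat n t X)\<^sup>2) \<le> 18 * v\<^sup>2 / \<tau>\<^sup>2"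
      using V_hat_second_moment[OF n t, of "\<lambda>_. p" v] p by (simp add: v_def \<tau>)
    also have "\<dots> \<le> 18 * v'\<^sup>2 / \<tau>\<^sup>2"
      using v v' by (intro divide_right_mono mult_left_mono power_mono) auto
    finally show "?E (\<lambda>X. (V_hat n t X)\<^sup>2) \<le> 18 * v'\<^sup>2 / \<tau>\<^sup>2" .
  qed simp
  also have "\<dots> = 18 / K1\<^sup>2"
    using v'(1) \<tau>(1) K1 by (simp add: power_mult_distrib power_divide)
  also have "\<dots> \<le> 18 / K1"
    using K1 mult_mono[of 1 K1 K1 K1] by (intro divide_left_mono) (auto simp: power2_eq_square)
  also have "\<dots> = \<alpha> / 2" using \<alpha> by (simp add: K1_def)
  finally have A_le: "?E (\<lambda>X. of_bool (A X)) \<le> \<alpha> / 2" .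
  have B_le: "?E (\<lambda>Y. of_bool (B Y)) \<le> \<alpha> / 2"
  proof (cases "C1 \<le> real n * v")
    case True
    then have v0: "0 < v" using C1 v n by (cases "v = 0") auto
    have "?E (\<lambda>Y. of_bool (B Y)) \<le> ?E (\<lambda>Y. (mu_hat n t Y - v)\<^sup>2) / (v / 2)\<^sup>2"
      using v0 by (intro chebyshev) (auto simp: B_def)
    also have "\<dots> \<le> (4 * v / real n) / (v / 2)\<^sup>2"
      using mu_hat_second_moment[OF n t, of p] p by (intro divide_right_mono) (auto simp: v_def)
    also have "\<dots> = 16 / (real n * v)" using v0 n by (simp add: power2_eq_square field_simps)
    also have "\<dots> \<le> 16 / C1" using True C1 by (intro divide_left_mono) auto
    also have "\<dots> = \<alpha> / 2" using \<alpha> by (simp add: C1_def)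
    finally show ?thesis .
  next
    case False
    then show ?thesis using \<alpha> by (simp add: B_def pexp_const)
  qed
  have "measure (two_samples n (binomial_mixture t \<pi>)) {z \<in> space (two_samples n (binomial_mixture t \<pi>)).
      R_stat n t \<gamma> z > K / (\<tau> * max 1 \<gamma>)} \<le> ?E (\<lambda>X. of_bool (A X)) + ?E (\<lambda>Y. of_bool (B Y))"
    unfolding mw[symmetric]
  proof (rule two_samples_union_bound[OF \<pi>'])
    fix X Y assume R: "K / (\<tau> * max 1 \<gamma>) < R_stat n t \<gamma> (X, Y)"
    show "A X \<or> B Y"
    proof (rule ccontr)
      assume neg: "\<not> (A X \<or> B Y)"
      define D where "D = max (mu_hat n t Y) \<gamma>"
      define G where "G = max 1 \<gamma>"
      have D: "0 < D" "\<gamma> \<le> D" "mu_hat n t Y \<le> D" and G: "1 \<le> G" "\<gamma> \<le> G"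
        using \<gamma>0 by (auto simp: D_def G_def)
      have V: "V_hat n t X * \<tau> \<le> K1 * v'" using neg pos_divide_le_eq[OF \<tau>(1), of "K1 * v'" "V_hat n t X"]
        by (simp add: A_def not_le)
      have "K1 * v' * G \<le> K * D"
      proof (cases "C1 \<le> real n * v")
        case True
        then have v'_eq: "v' = v" using n by (simp add: v'_def field_simps)
        have "v \<le> 2 * D" using neg True D by (auto simp: B_def)
        moreover have v\<gamma>: "v * \<gamma> \<le> 1 * \<gamma>" using v \<gamma>0 by (intro mult_right_mono) auto
        ultimately have "v * G \<le> 2 * D" 
        proof (cases "\<gamma> \<le> 1")
          case False
          then have G_eq: "G = \<gamma>" by (simp add: G_def)
          show ?thesis unfolding G_eq using v\<gamma> D(1,2) by linarith
        qed (simp add: G_def)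
        then have "K1 * (v * G) \<le> K1 * (2 * D)" using K1 by (intro mult_left_mono) auto
        also have "K1 * (2 * D) \<le> K1 * (2 * D) + K1 * C1 / c * D + K1 * C1 * D"
          using K1 C1 c D(1) by simp
        also have "\<dots> = K * D" unfolding K by (simp add: algebra_simps)
        finally show ?thesis by (simp add: v'_eq mult_ac)
      next
        case False
        then have v'_eq: "v' = C1 / real n" using n by (simp add: v'_def field_simps)
        have "G / real n \<le> D / c + D"
        proof (cases "\<gamma> \<le> 1")
          case True
          have "c / real n \<le> D" using \<gamma> D by simp
          then have "1 / real n \<le> D / c" using c by (simp add: pos_le_divide_eq)
          then show ?thesis using D(1) True by (simp add: G_def)
        next
          case False
          have "G / real n \<le> G / 1" using n G by (intro divide_left_mono) auto
          also have "\<dots> \<le> D" using False D by (simp add: G_def)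
          also have "D \<le> D / c + D" using D(1) c by simp
          finally show ?thesis .
        qed
        then have "K1 * C1 * (G / real n) \<le> K1 * C1 * (D / c + D)"
          using K1 C1 by (intro mult_left_mono) auto
        also have "\<dots> \<le> K1 * (2 * D) + K1 * C1 * (D / c + D)"
          using K1 D(1) by simp
        also have "\<dots> = K * D" unfolding K by (simp add: algebra_simps)
        finally show ?thesis by (simp add: v'_eq)
      qed
      moreover have "V_hat n t X * \<tau> * G \<le> K1 * v' * G" using V G by (intro mult_right_mono) auto
      ultimately have "V_hat n t X * (\<tau> * G) \<le> K * D" by (simp add: mult_ac)
      then have "V_hat n t X / D * (\<tau> * G) \<le> K"
        using D(1) by (simp add: pos_divide_le_eq)
      moreover have "0 < \<tau> * G" using \<tau>(1) G(1) by simp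
      ultimately have "V_hat n t X / D \<le> K / (\<tau> * G)" by (simp only: pos_le_divide_eq)
      then show False using R unfolding R_stat_def D_def G_def by simp
    qed
  qed
  also have "\<dots> \<le> \<alpha>" using A_le B_le by simp
  finally show ?thesis by (simp add: \<tau>_def)
qed

lemma mu_hat_le_1:
  assumes n: "2 \<le> n" and Y: "Y \<in> {..<n} \<rightarrow>\<^sub>E {..t}"
  shows "mu_hat n t Y \<le> 1"
proof -
  have "(\<Sum>j<n. \<Sum>i<j. h_tilde t (Y i) (Y j) / 2) \<le> (\<Sum>j<n. \<Sum>i<j. 1)"
  proof (intro sum_mono)
    fix j i assume ij: "j \<in> {..<n}" "i \<in> {..<j}"
    have "Y i \<le> t" "Y j \<le> t" using Y ij by (auto simp: PiE_iff)
    then have "real (Y i) / real t \<le> 1" "real (Y j) / real t \<le> 1"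
      by (auto simp: divide_le_eq_1)
    moreover have "0 \<le> real (Y i) * real (Y j) / (real t)\<^sup>2" by simp
    moreover have "(x + y - 2 * z) / 2 \<le> 1" if "x \<le> 1" "y \<le> 1" "0 \<le> z" for x y z :: real
      using that by simp
    ultimately show "h_tilde t (Y i) (Y j) / 2 \<le> 1" unfolding h_tilde_def by blast
  qed
  also have "\<dots> = real (n choose 2)"
    using sum_pairs_const[where a=1 and n=n] by (simp add: real_choose_two)
  finally show ?thesis using n by (simp add: mu_hat_def divide_le_eq_1 zero_less_binomial)
qed

text \<open>Since \<open>mu_hat\<close> is at most 1, the denominator is at most
  \<open>max 1 \<gamma>\<close>, and this factor cancels against the one in the bound for
  the threshold.\<close>

lemma cochran_test_type_II:
  assumes \<alpha>: "0 < \<alpha>" "\<alpha> < 1" and c: "0 < c" and n: "2 \<le> n" and t: "2 \<le> t"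
    and \<gamma>: "c / real n \<le> \<gamma>" and \<pi>: "\<pi> \<in> mixing_dists"
  defines "K \<equiv> 36 / \<alpha> * (2 + 32 / \<alpha> / c + 32 / \<alpha>)"
  shows "measure (two_samples n (binomial_mixture t \<pi>))
      {z \<in> space (two_samples n (binomial_mixture t \<pi>)). cochran_test \<alpha> n t \<gamma> z = 0}
    \<le> pexp n t (\<lambda>_. mix_weight t \<pi>) (\<lambda>X. of_bool (V_hat n t X \<le> K / (real t * sqrt (real n))))"
proof -
  define \<tau> where "\<tau> = real t * sqrt (real n)"
  have \<tau>: "0 < \<tau>" using n t by (auto simp: \<tau>_def)
  have K: "0 \<le> K" using \<alpha> c by (simp add: K_def)
  have \<gamma>0: "0 < \<gamma>" using \<gamma> c n less_le_trans[of 0 "c / real n" \<gamma>] by simp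
  define thr where "thr = (SUP \<pi>\<in>point_masses. upper_quantile \<alpha> n (binomial_mixture t \<pi>) (R_stat n t \<gamma>))"
  have thr_le: "thr \<le> K / (\<tau> * max 1 \<gamma>)"
    unfolding thr_def
  proof (rule cSUP_least)
    show "point_masses \<noteq> {}" by (auto simp: point_masses_def)
    fix \<rho> assume \<rho>: "\<rho> \<in> point_masses"
    then have "\<rho> \<in> mixing_dists" using point_masses_subset by blast
    then show "upper_quantile \<alpha> n (binomial_mixture t \<rho>) (R_stat n t \<gamma>) \<le> K / (\<tau> * max 1 \<gamma>)"
      unfolding K_def \<tau>_def
      using null_R_stat_tail[OF \<alpha> c n t \<gamma> \<rho>] \<alpha> by (intro upper_quantile_le) simp_all
  qed
  interpret product_weights n t "\<lambda>_. mix_weight t \<pi>" by (rule product_weights_mix) fact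
  have "measure (two_samples n (binomial_mixture t \<pi>))
      {z \<in> space (two_samples n (binomial_mixture t \<pi>)). cochran_test \<alpha> n t \<gamma> z = 0}
    \<le> pexp n t (\<lambda>_. mix_weight t \<pi>) (\<lambda>X. of_bool (V_hat n t X \<le> K / \<tau>)) +
      pexp n t (\<lambda>_. mix_weight t \<pi>) (\<lambda>Y. of_bool False)"
  proof (rule two_samples_union_bound[OF \<pi>])
    fix X Y assume Y: "Y \<in> {..<n} \<rightarrow>\<^sub>E {..t}" and zero: "cochran_test \<alpha> n t \<gamma> (X, Y) = 0"
    have "cochran_test \<alpha> n t \<gamma> (X, Y) = (if thr < R_stat n t \<gamma> (X, Y) then 1 else 0)"
      by (simp only: cochran_test_def thr_def)
    with zero have "R_stat n t \<gamma> (X, Y) \<le> thr"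
      by (cases "thr < R_stat n t \<gamma> (X, Y)") simp_all
    also note thr_le
    finally have R: "R_stat n t \<gamma> (X, Y) \<le> K / (\<tau> * max 1 \<gamma>)" .
    define D where "D = max (mu_hat n t Y) \<gamma>"
    define G where "G = max 1 \<gamma>"
    have D: "0 < D" using \<gamma>0 by (simp add: D_def less_max_iff_disj)
    have G: "1 \<le> G" and DG: "D \<le> G"
      unfolding D_def G_def using mu_hat_le_1[OF n Y] by (simp, rule max.mono) simp
    have "V_hat n t X / D \<le> K / (\<tau> * G)"
      using R unfolding R_stat_def prod.case D_def G_def .
    then have "V_hat n t X \<le> K / (\<tau> * G) * D" using D by (simp only: pos_divide_le_eq)
    also have "\<dots> \<le> K / (\<tau> * G) * G"
      using K \<tau> G by (intro mult_left_mono[OF DG] divide_nonneg_nonneg) simp_all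
    also have "\<dots> = K / \<tau>" using G by simp
    finally show "V_hat n t X \<le> K / \<tau> \<or> False" by simp
  qed
  also have "pexp n t (\<lambda>_. mix_weight t \<pi>) (\<lambda>Y. of_bool False) = 0"
    using pexp_const[of 0] by simp
  finally show ?thesis by (simp add: \<tau>_def)
qed

section \<open>Optimality of the test\<close>

theorem theorem5:
  fixes \<alpha> \<beta> c :: real
  assumes "0 < \<alpha>" and "\<alpha> < 1" and "0 < \<beta>" and "\<beta> < 1 - \<alpha>" and "0 < c"
  shows "(\<forall>n\<ge>2. \<forall>t\<ge>2. \<forall>\<gamma>\<ge>c / real n. \<forall>\<pi>\<in>point_masses.
            measure (two_samples n (binomial_mixture t \<pi>))
              {z \<in> space (two_samples n (binomial_mixture t \<pi>)). cochran_test \<alpha> n t \<gamma> z = 1} \<le> \<alpha>)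
       \<and> (\<exists>C>0. \<exists>N\<ge>2. \<forall>n\<ge>N. \<forall>t\<ge>2. \<forall>\<gamma>\<ge>c / real n.
            \<forall>\<epsilon>\<ge>C * critical_separation \<alpha> \<beta> n t point_masses.
            \<forall>\<pi>\<in>mixing_dists. W1_set \<pi> point_masses \<ge> \<epsilon> \<longrightarrow>
              measure (two_samples n (binomial_mixture t \<pi>))
                {z \<in> space (two_samples n (binomial_mixture t \<pi>)). cochran_test \<alpha> n t \<gamma> z = 0} \<le> \<beta>)"
proof (intro conjI)
  show "\<forall>n\<ge>2. \<forall>t\<ge>2. \<forall>\<gamma>\<ge>c / real n. \<forall>\<pi>\<in>point_masses.
      measure (two_samples n (binomial_mixture t \<pi>))
        {z \<in> space (two_samples n (binomial_mixture t \<pi>)). cochran_test \<alpha> n t \<gamma> z = 1} \<le> \<alpha>"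
    using assms by (intro allI impI ballI cochran_test_level) auto
next
  define K where "K = 36 / \<alpha> * (2 + 32 / \<alpha> / c + 32 / \<alpha>)"
  have K: "0 \<le> K" using assms by (simp add: K_def)
  \<comment> \<open>makes the Chebyshev part 29 / L of the type II error at most half of \<open>\<beta>\<close>\<close>
  define L where "L = 2 * K + 58 / \<beta>"
  have \<beta>1: "\<beta> < 1" using assms by simp
  have "58 \<le> 58 / \<beta>" using assms \<beta>1 by (simp add: field_simps)
  then have L: "1 \<le> L" "2 * K \<le> L" "58 / \<beta> \<le> L" using K unfolding L_def by linarith+
  have L29: "29 / L \<le> \<beta> / 2"
  proof -
    have "29 / L \<le> 29 / (58 / \<beta>)" using L assms by (intro divide_left_mono) auto
    then show ?thesis by simp
  qed
  define \<kappa> where "\<kappa> = (1 - \<alpha> - \<beta>) / 12"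
  have \<kappa>: "0 < \<kappa>" using assms by (simp add: \<kappa>_def)
  \<comment> \<open>the second term makes the sample variance large enough, the third handles the exponential part\<close>
  define C where "C = 1 + 64 * L / \<kappa> + 48 / (\<beta> * (1 - \<beta>))"
  have pos: "0 \<le> 64 * L / \<kappa>" "0 \<le> 48 / (\<beta> * (1 - \<beta>))" using L \<kappa> assms \<beta>1 by auto
  then have C: "1 \<le> C" "64 * L / \<kappa> \<le> C" "48 / (\<beta> * (1 - \<beta>)) \<le> C" by (auto simp: C_def)
  have power: "measure (two_samples n (binomial_mixture t \<pi>))
      {z \<in> space (two_samples n (binomial_mixture t \<pi>)). cochran_test \<alpha> n t \<gamma> z = 0} \<le> \<beta>"
    if n: "2 \<le> n" and t: "2 \<le> t" and \<gamma>: "c / real n \<le> \<gamma>" and \<pi>: "\<pi> \<in> mixing_dists"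
      and sep: "C * critical_separation \<alpha> \<beta> n t point_masses \<le> W1_set \<pi> point_masses"
    for n t \<gamma> \<pi>
  proof -
    define \<epsilon> where "\<epsilon> = W1_set \<pi> point_masses"
    define \<tau> where "\<tau> = real t * sqrt (real n)"
    have \<tau>: "0 < \<tau>" using n t by (simp add: \<tau>_def)
    have "C * ((1 - \<beta>) / (2 * real n)) \<le> C * critical_separation \<alpha> \<beta> n t point_masses"
      using assms n t C by (intro mult_left_mono critical_separation_ge_inverse_n) auto
    then have \<epsilon>1: "C * ((1 - \<beta>) / (2 * real n)) \<le> \<epsilon>" using sep by (simp add: \<epsilon>_def)
    have "C * sqrt (\<kappa> / \<tau>) \<le> C * critical_separation \<alpha> \<beta> n t point_masses"
      unfolding \<kappa>_def \<tau>_def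
      using assms n t C by (intro mult_left_mono critical_separation_ge_local) auto
    then have \<epsilon>2: "C * sqrt (\<kappa> / \<tau>) \<le> \<epsilon>" using sep by (simp add: \<epsilon>_def)
    have \<epsilon>0: "0 \<le> \<epsilon>"
      using \<epsilon>2 C \<kappa> \<tau> by (intro order.trans[OF _ \<epsilon>2] mult_nonneg_nonneg) auto
    have var: "L / \<tau> \<le> \<epsilon>\<^sup>2 / 64"
    proof -
      have "64 * L \<le> C * \<kappa>" using C \<kappa> by (simp add: field_simps)
      also have "\<dots> \<le> C\<^sup>2 * \<kappa>" using C \<kappa> by (intro mult_right_mono) (auto simp: power2_eq_square)
      finally have "64 * L / \<tau> \<le> C\<^sup>2 * \<kappa> / \<tau>" using \<tau> by (intro divide_right_mono) auto
      also have "\<dots> = (C * sqrt (\<kappa> / \<tau>))\<^sup>2" using \<kappa> \<tau> by (simp add: power_mult_distrib)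
      also have "\<dots> \<le> \<epsilon>\<^sup>2" using \<epsilon>2 C \<kappa> \<tau> by (intro power_mono) auto
      finally show ?thesis by (simp add: mult.commute)
    qed
    have exp_le: "exp (- (real (n div 2) * \<epsilon> / 4)) \<le> \<beta> / 2"
    proof -
      have n3: "real n / 3 \<le> real (n div 2)"
      proof -
        have "n \<le> 3 * (n div 2)" using n by presburger
        then have "real n \<le> real (3 * (n div 2))" by (rule of_nat_mono)
        then show ?thesis by simp
      qed
      have "2 / \<beta> = 48 / (\<beta> * (1 - \<beta>)) * ((1 - \<beta>) / 24)" using assms \<beta>1 by (simp add: field_simps)
      also have "\<dots> \<le> C * ((1 - \<beta>) / 24)" using C \<beta>1 by (intro mult_right_mono) auto
      also have "\<dots> = real n / 3 * (C * ((1 - \<beta>) / (2 * real n))) / 4" using n by simp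
      also have "\<dots> \<le> real (n div 2) * \<epsilon> / 4"
        using n3 \<epsilon>1 C \<beta>1 by (intro divide_right_mono mult_mono) auto
      also have "\<dots> \<le> exp (real (n div 2) * \<epsilon> / 4)"
        using exp_ge_add_one_self[of "real (n div 2) * \<epsilon> / 4"] by linarith
      finally have "2 / \<beta> \<le> exp (real (n div 2) * \<epsilon> / 4)" .
      then have "1 / exp (real (n div 2) * \<epsilon> / 4) \<le> 1 / (2 / \<beta>)"
        using assms by (intro divide_left_mono) auto
      then show ?thesis by (simp add: exp_minus inverse_eq_divide)
    qed
    have "measure (two_samples n (binomial_mixture t \<pi>))
        {z \<in> space (two_samples n (binomial_mixture t \<pi>)). cochran_test \<alpha> n t \<gamma> z = 0}
      \<le> pexp n t (\<lambda>_. mix_weight t \<pi>) (\<lambda>X. of_bool (V_hat n t X \<le> K / (real t * sqrt (real n))))"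
      unfolding K_def using assms n t \<gamma> \<pi> by (intro cochran_test_type_II)
    also have "\<dots> \<le> 29 / L + exp (- (real (n div 2) * \<epsilon> / 4))"
      using var \<epsilon>0 by (intro V_hat_lower_tail n t \<pi> L) (auto simp: \<epsilon>_def \<tau>_def)
    also have "\<dots> \<le> \<beta>" using L29 exp_le by simp
    finally show ?thesis .
  qed
  show "\<exists>C>0. \<exists>N\<ge>2. \<forall>n\<ge>N. \<forall>t\<ge>2. \<forall>\<gamma>\<ge>c / real n.
      \<forall>\<epsilon>\<ge>C * critical_separation \<alpha> \<beta> n t point_masses.
      \<forall>\<pi>\<in>mixing_dists. W1_set \<pi> point_masses \<ge> \<epsilon> \<longrightarrow>
        measure (two_samples n (binomial_mixture t \<pi>))
          {z \<in> space (two_samples n (binomial_mixture t \<pi>)). cochran_test \<alpha> n t \<gamma> z = 0} \<le> \<beta>"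
  proof (intro exI[of _ C] exI[of _ "2::nat"] conjI allI impI ballI)
    fix n t :: nat and \<gamma> \<epsilon> :: real and \<pi>
    assume "2 \<le> n" "2 \<le> t" "c / real n \<le> \<gamma>" "\<pi> \<in> mixing_dists"
      and "C * critical_separation \<alpha> \<beta> n t point_masses \<le> \<epsilon>" "\<epsilon> \<le> W1_set \<pi> point_masses"
    then show "measure (two_samples n (binomial_mixture t \<pi>))
        {z \<in> space (two_samples n (binomial_mixture t \<pi>)). cochran_test \<alpha> n t \<gamma> z = 0} \<le> \<beta>"
      by (intro power) auto
  qed (use C in auto)
qed

end
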